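(* Let $\psi$ be a primitive Dirichlet character mod $q$ with $q>1$ and $\psi(-1)=1$ (i.e. $\psi(q-1)=1$). For each $n\geq1$ put $$S_n=\sum_{\substack{m=1\\ \gcd(m,n)=1}}^{\lfloor\frac{nq-1}{2}\rfloor}\psi(m)\,\chi_{(\frac{2m}{nq},1)}.$$ (1) If $v$ is a product of some distinct primes and $\gcd(v,q)=1$, then $S_v\in\mathcal{C}$. (2) Let $u$ be a positive even integer and let $\{c_d:d\mid u\}$ be complex numbers with $|c_1|>(\mathbf d(uu')-1)\cdot\max\{|c_d|:d\mid u,\ d>1\}$, where $u'$ is the largest divisor of $u$ relatively prime to $q$ and $\mathbf d(n)$ is the number of positive divisors of $n$. Then $\sum_{d\mid u}c_dS_d\in\mathcal{C}$.
   Context: $\chi_A$ is the characteristic function of $A\subseteq(0,1)$. $L^2=L^2(0,1)$; functions are identified with their odd $2$-periodic extensions to $\mathbb{R}$; $\mathcal{C}$ is the set of $\varphi\in L^2$ such that the span of $\{\varphi(kx):k\in\mathbb{N}\}$ is dense in $L^2$. A Dirichlet character mod $q$ is a completely multiplicative $q$-periodic function $\chi$ on $\mathbb{N}$ with $\chi(n)\ne0$ iff $\gcd(n,q)=1$ (extended $q$-periodically to $\mathbb{Z}$); it is primitive if it is not of the form $\psi\chi_q$ with $\psi$ a character of modulus a proper divisor of $q$ and $\chi_q$ the principal character mod $q$. *)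

theory Defs
  imports "HOL-Analysis.Analysis" "HOL-Computational_Algebra.Squarefree"
begin

definition L2_01 :: "(real \<Rightarrow> complex) set" where
  "L2_01 = {f. f \<in> borel_measurable (lebesgue_on {0<..<1}) \<and>
               integrable (lebesgue_on {0<..<1}) (\<lambda>x. (norm (f x))^2)}"

definition odd_ext :: "(real \<Rightarrow> complex) \<Rightarrow> real \<Rightarrow> complex" where
  "odd_ext f x = (let y = x - 2 * of_int \<lfloor>x / 2\<rfloor> in
      if 0 < y \<and> y < 1 then f y
      else if 1 < y \<and> y < 2 then - f (2 - y) else 0)"

definition cyclic_C :: "(real \<Rightarrow> complex) \<Rightarrow> bool" where
  "cyclic_C \<phi> \<longleftrightarrow> \<phi> \<in> L2_01 \<and>
     (\<forall>g\<in>L2_01. \<forall>\<epsilon>>0. \<exists>(N::nat) (a::nat \<Rightarrow> complex).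
        (LINT x|lebesgue_on {0<..<1}.
           (norm (g x - (\<Sum>k\<in>{1..N}. a k * odd_ext \<phi> (real k * x))))^2) < \<epsilon>)"

definition dirichlet_char :: "nat \<Rightarrow> (nat \<Rightarrow> complex) \<Rightarrow> bool" where
  "dirichlet_char q chr \<longleftrightarrow> q > 0 \<and>
     (\<forall>m n. chr (m * n) = chr m * chr n) \<and>
     (\<forall>n. chr (n + q) = chr n) \<and>
     (\<forall>n. chr n \<noteq> 0 \<longleftrightarrow> coprime n q)"

definition principal_char :: "nat \<Rightarrow> nat \<Rightarrow> complex" where
  "principal_char q n = (if coprime n q then 1 else 0)"

definition primitive_char :: "nat \<Rightarrow> (nat \<Rightarrow> complex) \<Rightarrow> bool" where
  "primitive_char q chr \<longleftrightarrow> dirichlet_char q chr \<and>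
     \<not> (\<exists>d \<psi>. d dvd q \<and> d < q \<and> dirichlet_char d \<psi> \<and>
              (\<forall>n. chr n = \<psi> n * principal_char q n))"

definition S_fun :: "(nat \<Rightarrow> complex) \<Rightarrow> nat \<Rightarrow> nat \<Rightarrow> real \<Rightarrow> complex" where
  "S_fun \<psi> q n x = (\<Sum>m\<in>{m\<in>{1..(n * q - 1) div 2}. coprime m n}.
      \<psi> m * (if 2 * real m / real (n * q) < x \<and> x < 1 then 1 else 0))"

definition num_divisors :: "nat \<Rightarrow> nat" where
  "num_divisors n = card {d. d dvd n}"

end

theory Submission
  imports Defs "HOL-Number_Theory.Cong"
begin

text \<open>
  Write $T_k$ for the isometry $f(x) \mapsto f(kx)$. On irrational points $S_n(x)$ is the character
  sum of $\psi$ over $m \le nqx/2$ prime to $n$, so sieving by one more prime gives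
  $S_{pn} = T_p S_n - \psi(p) S_n$ if $p \nmid n$ and $S_{pn} = T_p S_n$ otherwise.
  Hence every $S_n$ is a polynomial in dilations applied to $S_1$, and this polynomial can be inverted
  in the closed dilation-invariant subspace generated by the function in question: for (1) the factors
  $1 - cT_p$ with $|c| = 1$ have dense range (Cesaro means of $c^jT_p^j$ tend to $0$ strongly), for (2)
  a Neumann series converges. So the subspace contains $S_1$. By the Gauss sum formula the $k$-th
  sine coefficient of $S_1$ is a nonzero constant times $\overline{\psi(k)}/k$, which is completely
  multiplicative; applying $\prod_{p \le P} (1 - \overline{\psi(p)} p^{-1} T_p)$ and letting
  $P \to \infty$ produces $\sin(\pi x)$, whose dilates span a dense subspace.
\<close>

text \<open>For |c| = 1 a Neumann series cannot invert 1 - cT_p, since T_p is an isometry. The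
  Cesaro means succeed because T_p^j turns sin(pi k x) into sin(pi p^j k x), and these are pairwise
  orthogonal for p >= 2. In part (1), v squarefree and prime to q make every factor T_p - \<psi>(p)
  with |\<psi>(p)| = 1; a bare T_p has a proper closed range and could not be undone. In part (2),
  S_d is a combination of dilates of S_1 whose coefficients have absolute sum 2^r, where r counts
  the primes dividing d but not q. These powers add up to at most d(uu') over d | u, and the term d
  = 1 is the 1 that is subtracted. Primitivity gives the Gauss sum formula also at k not prime to q,
  so that the coefficients are completely multiplicative on all of the positive integers. Evenness
  makes the odd 2-periodic extension of S_n a plain character sum and removes the cos(pi k) terms
  from the coefficients. The step functions satisfy their identities only off the jumps, so equality
  is used up to seminorm 0, which closed subspaces absorb.\<close>

abbreviation I01 :: "real measure" where "I01 \<equiv> lebesgue_on {0<..<1}"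

section \<open>The L2 seminorm on (0,1)\<close>

definition nrm :: "(real \<Rightarrow> complex) \<Rightarrow> real" where
  "nrm f = sqrt (LINT x|I01. (norm (f x))^2)"

lemma nrm_nonneg [simp]: "nrm f \<ge> 0"
  by (simp add: nrm_def)

lemma nrm_square: "(nrm f)^2 = (LINT x|I01. (norm (f x))^2)"
  by (simp add: nrm_def)

lemma L2_01_measurable: "f \<in> L2_01 \<Longrightarrow> f \<in> borel_measurable I01"
  and L2_01_integrable: "f \<in> L2_01 \<Longrightarrow> integrable I01 (\<lambda>x. (norm (f x))^2)"
  by (auto simp: L2_01_def)

text \<open>The cross term is bounded by expanding (s|a| - |b|)^2 / s >= 0. The free weight
  \<open>s\<close> lets \<open>nrm_triangle\<close> reach Minkowski's inequality without
  Cauchy-Schwarz.\<close>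

lemma norm_add_square_le:
  fixes a b :: complex and s :: real
  assumes "s > 0"
  shows "(norm (a + b))^2 \<le> (1 + s) * (norm a)^2 + (1 + 1/s) * (norm b)^2"
proof -
  have "0 \<le> (s * norm a - norm b)^2 / s" using assms by simp
  also have "\<dots> = s * (norm a)^2 + (1/s) * (norm b)^2 - 2 * norm a * norm b"
    using assms by (simp add: power2_eq_square field_simps)
  finally have *: "2 * norm a * norm b \<le> s * (norm a)^2 + (1/s) * (norm b)^2" by simp
  have "(norm (a + b))^2 \<le> (norm a + norm b)^2"
    by (simp add: norm_triangle_ineq power_mono)
  also have "\<dots> = (norm a)^2 + (norm b)^2 + 2 * norm a * norm b"
    by (simp add: power2_eq_square algebra_simps)
  finally show ?thesis using * by (simp add: algebra_simps)
qed

lemma L2_01_add: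
  assumes "f \<in> L2_01" "g \<in> L2_01"
  shows "(\<lambda>x. f x + g x) \<in> L2_01"
proof -
  have [measurable]: "f \<in> borel_measurable I01" "g \<in> borel_measurable I01"
    using assms by (auto simp: L2_01_def)
  have "integrable I01 (\<lambda>x. 2 * (norm (f x))^2 + 2 * (norm (g x))^2)"
    using assms by (intro Bochner_Integration.integrable_add) (auto simp: L2_01_def)
  then have "integrable I01 (\<lambda>x. (norm (f x + g x))^2)"
  proof (rule Bochner_Integration.integrable_bound)
    show "AE x in I01. norm ((norm (f x + g x))\<^sup>2) \<le> norm (2 * (norm (f x))\<^sup>2 + 2 * (norm (g x))\<^sup>2)"
      using norm_add_square_le[of 1] by (intro AE_I2) (simp add: abs_of_nonneg)
  qed measurable
  then show ?thesis by (simp add: L2_01_def)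
qed

lemma L2_01_scale:
  assumes "f \<in> L2_01"
  shows "(\<lambda>x. c * f x) \<in> L2_01"
  using assms by (auto simp: L2_01_def norm_mult power_mult_distrib)

lemma L2_01_diff:
  assumes "f \<in> L2_01" "g \<in> L2_01"
  shows "(\<lambda>x. f x - g x) \<in> L2_01"
  using L2_01_add[OF assms(1) L2_01_scale[OF assms(2), of "-1"]] by simp

lemma nrm_scale: "nrm (\<lambda>x. c * f x) = norm c * nrm f"
  by (simp add: nrm_def norm_mult power_mult_distrib real_sqrt_mult)

lemma nrm_triangle:
  assumes "f \<in> L2_01" "g \<in> L2_01"
  shows "nrm (\<lambda>x. f x + g x) \<le> nrm f + nrm g"
proof (rule field_le_epsilon)
  fix e :: real assume "e > 0"
  \<comment> \<open>The padding e/2 keeps both numbers positive even if a norm is 0; s = b/a is the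
    weight for which the bound becomes exactly (a + b)^2.\<close>
  define a b where "a = nrm f + e/2" and "b = nrm g + e/2"
  have pos: "a > 0" "b > 0" using \<open>e > 0\<close> by (auto simp: a_def b_def add_nonneg_pos)
  define s where "s = b / a"
  have s: "s > 0" using pos by (simp add: s_def)
  have "(nrm (\<lambda>x. f x + g x))^2 \<le>
      (LINT x|I01. (1 + s) * (norm (f x))^2 + (1 + 1/s) * (norm (g x))^2)"
    unfolding nrm_square
  proof (rule integral_mono)
    show "integrable I01 (\<lambda>x. (1 + s) * (norm (f x))^2 + (1 + 1/s) * (norm (g x))^2)"
      using assms by (intro Bochner_Integration.integrable_add integrable_mult_right) (auto simp: L2_01_def)
  qed (use L2_01_integrable[OF L2_01_add[OF assms]] norm_add_square_le[OF s] in auto)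
  also have "\<dots> = (1 + s) * (nrm f)^2 + (1 + 1/s) * (nrm g)^2"
    using assms by (subst Bochner_Integration.integral_add) (auto simp: L2_01_def nrm_square)
  also have "\<dots> \<le> (1 + s) * a^2 + (1 + 1/s) * b^2"
    using s \<open>e > 0\<close> by (intro add_mono mult_left_mono power_mono) (auto simp: a_def b_def)
  also have "\<dots> = (a + b)^2"
    using pos by (simp add: s_def field_simps power2_eq_square)
  finally have "nrm (\<lambda>x. f x + g x) \<le> a + b"
    by (rule power2_le_imp_le) (use pos in auto)
  then show "nrm (\<lambda>x. f x + g x) \<le> nrm f + nrm g + e" by (simp add: a_def b_def)
qed

lemma nrm_triangle3:
  assumes "f \<in> L2_01" "g \<in> L2_01" "h \<in> L2_01"
  shows "nrm (\<lambda>x. f x - h x) \<le> nrm (\<lambda>x. f x - g x) + nrm (\<lambda>x. g x - h x)"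
  using nrm_triangle[OF L2_01_diff[OF assms(1,2)] L2_01_diff[OF assms(2,3)]] by simp

lemma bounded_in_L2_01:
  assumes "f \<in> borel_measurable I01" "\<And>x. x \<in> {0<..<1} \<Longrightarrow> norm (f x) \<le> B"
  shows "f \<in> L2_01"
proof -
  have [measurable]: "f \<in> borel_measurable I01" by fact
  have "integrable I01 (\<lambda>x. (norm (f x))^2)"
  proof (rule Bochner_Integration.integrable_bound)
    show "integrable I01 (\<lambda>x. B^2)"
      by (intro finite_measure.integrable_const finite_measure_lebesgue_on) simp
    show "AE x in I01. norm ((norm (f x))\<^sup>2) \<le> norm (B^2)"
      using assms(2) by (intro AE_I2) (simp add: power_mono space_restrict_space)
  qed measurable
  then show ?thesis by (simp add: L2_01_def)
qed

lemma nrm_le_bound: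
  assumes "f \<in> borel_measurable I01" "\<And>x. x \<in> {0<..<1} \<Longrightarrow> norm (f x) \<le> B" "B \<ge> 0"
  shows "nrm f \<le> B"
proof -
  have "(nrm f)^2 \<le> (LINT x|I01. B^2)"
    unfolding nrm_square
    by (intro integral_mono L2_01_integrable bounded_in_L2_01[OF assms(1,2)])
       (use assms in \<open>auto intro!: power_mono finite_measure.integrable_const finite_measure_lebesgue_on\<close>)
  also have "\<dots> = B^2"
    by (simp add: measure_restrict_space)
  finally show ?thesis using assms(3) power2_le_imp_le by blast
qed

lemma borel_measurable_I01 [measurable (raw)]:
  "f \<in> borel_measurable borel \<Longrightarrow> f \<in> borel_measurable I01"
  by (intro measurable_restrict_space1 measurable_completion) simp

section \<open>Odd periodic functions and their dilations\<close>

text \<open>Working with bounded Borel functions makes squares and products with sines integrable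
  and keeps measurability under x -> kx. Symmetry and period are imposed at every point, so |f|^2 is
  even and 2-periodic.\<close>

definition periodic_odd :: "(real \<Rightarrow> complex) set" where
  "periodic_odd = {f. f \<in> borel_measurable borel \<and> bounded (range f) \<and>
      (\<forall>x. f (- x) = - f x) \<and> (\<forall>x. f (x + 2) = f x)}"

definition dil :: "nat \<Rightarrow> (real \<Rightarrow> complex) \<Rightarrow> real \<Rightarrow> complex" where
  "dil k f x = f (real k * x)"

definition sn :: "nat \<Rightarrow> real \<Rightarrow> complex" where
  "sn k x = complex_of_real (sin (pi * (real k * x)))"

lemma periodic_oddI:
  assumes "f \<in> borel_measurable borel" "\<And>x. norm (f x) \<le> B"
    "\<And>x. f (- x) = - f x" "\<And>x. f (x + 2) = f x"
  shows "f \<in> periodic_odd"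
  using assms by (auto simp: periodic_odd_def bounded_iff)

lemma periodic_odd_measurable: "f \<in> periodic_odd \<Longrightarrow> f \<in> borel_measurable borel"
  and periodic_odd_minus: "f \<in> periodic_odd \<Longrightarrow> f (- x) = - f x"
  and periodic_odd_period: "f \<in> periodic_odd \<Longrightarrow> f (x + 2) = f x"
  by (auto simp: periodic_odd_def)

lemma periodic_odd_bounded:
  assumes "f \<in> periodic_odd"
  obtains B where "\<And>x. norm (f x) \<le> B" "B \<ge> 0"
proof -
  obtain B where "\<And>x. norm (f x) \<le> B" using assms by (auto simp: periodic_odd_def bounded_iff)
  moreover from this[of 0] have "B \<ge> 0" using norm_ge_zero order_trans by blast
  ultimately show ?thesis using that by blast
qed

lemma periodic_odd_L2: "f \<in> periodic_odd \<Longrightarrow> f \<in> L2_01"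
  using periodic_odd_bounded by (metis bounded_in_L2_01 borel_measurable_I01 periodic_odd_measurable)

lemma periodic_odd_zero: "(\<lambda>x. 0) \<in> periodic_odd"
  by (rule periodic_oddI[where B = 0]) auto

lemma periodic_odd_add:
  assumes "f \<in> periodic_odd" "g \<in> periodic_odd"
  shows "(\<lambda>x. f x + g x) \<in> periodic_odd"
proof -
  obtain B1 B2 where "\<And>x. norm (f x) \<le> B1" "\<And>x. norm (g x) \<le> B2"
    using assms periodic_odd_bounded by metis
  then have "norm (f x + g x) \<le> B1 + B2" for x by (meson add_mono norm_triangle_le)
  then show ?thesis using assms
    by (intro periodic_oddI[where B = "B1 + B2"]) (auto simp: periodic_odd_def)
qed

lemma periodic_odd_scale:
  assumes "f \<in> periodic_odd"
  shows "(\<lambda>x. c * f x) \<in> periodic_odd"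
proof -
  obtain B where "\<And>x. norm (f x) \<le> B"
    using assms periodic_odd_bounded by metis
  then have "norm (c * f x) \<le> norm c * B" for x by (simp add: norm_mult mult_left_mono)
  then show ?thesis using assms
    by (intro periodic_oddI[where B = "norm c * B"]) (auto simp: periodic_odd_def)
qed

lemma periodic_odd_diff:
  assumes "f \<in> periodic_odd" "g \<in> periodic_odd"
  shows "(\<lambda>x. f x - g x) \<in> periodic_odd"
  using periodic_odd_add[OF assms(1) periodic_odd_scale[OF assms(2), of "-1"]] by simp

lemma periodic_odd_sum:
  assumes "\<And>i. i \<in> I \<Longrightarrow> f i \<in> periodic_odd"
  shows "(\<lambda>x. \<Sum>i\<in>I. f i x) \<in> periodic_odd"
  using assms
  by (induction I rule: infinite_finite_induct) (auto intro: periodic_odd_zero periodic_odd_add)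

lemma periodic_nat:
  assumes "\<And>x. f (x + 2) = f (x::real)"
  shows "f (x + 2 * real k) = f x"
proof (induction k)
  case (Suc k)
  have "f (x + 2 * real (Suc k)) = f ((x + 2 * real k) + 2)" by (simp add: algebra_simps)
  then show ?case using Suc assms by metis
qed simp

lemma periodic_int:
  assumes "\<And>x. f (x + 2) = f (x::real)"
  shows "f (x + 2 * real_of_int k) = f x"
proof (cases "k \<ge> 0")
  case True then show ?thesis using periodic_nat[where f = f and x = x and k = "nat k", OF assms] by simp
next
  case False then show ?thesis using 
    periodic_nat[where f = f and x = "x + 2 * real_of_int k" and k = "nat (-k)", OF assms] by simp
qed

lemma periodic_odd_dil:
  assumes "f \<in> periodic_odd"
  shows "dil k f \<in> periodic_odd"
proof -
  have [measurable]: "f \<in> borel_measurable borel" using assms by (simp add: periodic_odd_measurable)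
  obtain B where B: "\<And>x. norm (f x) \<le> B" using assms periodic_odd_bounded by metis
  show ?thesis
  proof (rule periodic_oddI[where B = B])
    show "dil k f \<in> borel_measurable borel" unfolding dil_def by measurable
    show "dil k f (x + 2) = dil k f x" for x
      using periodic_nat[of f "real k * x" k, OF periodic_odd_period[OF assms]]
      by (simp add: dil_def algebra_simps)
  qed (auto simp: dil_def B periodic_odd_minus[OF assms])
qed

lemma periodic_odd_sn: "sn k \<in> periodic_odd"
proof (rule periodic_oddI[where B = 1])
  show "sn k \<in> borel_measurable borel" unfolding sn_def by measurable
  show "sn k (x + 2) = sn k x" for x
    using sin.plus_of_nat[of "pi * (real k * x)" k] by (simp add: sn_def algebra_simps)
qed (auto simp: sn_def norm_of_real)

lemma dil_sn: "dil k (sn n) = sn (k * n)"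
  by (auto simp: dil_def sn_def fun_eq_iff mult_ac)

lemma dil_1 [simp]: "dil (Suc 0) f = f"
  by (auto simp: dil_def fun_eq_iff)

section \<open>Dilations preserve the norm\<close>

lemma LINT_I01_eq_integral:
  fixes f :: "real \<Rightarrow> 'a :: euclidean_space"
  assumes "f \<in> borel_measurable borel" "\<And>x. norm (f x) \<le> B"
  shows "integrable I01 f" "(LINT x|I01. f x) = integral {0..1} f"
    "f integrable_on {a..b}"
proof -
  have *: "integrable (lebesgue_on S) f" if "S \<in> lmeasurable" for S
  proof -
    interpret finite_measure "lebesgue_on S" using that finite_measure_lebesgue_on by blast
    have "f \<in> borel_measurable (lebesgue_on S)"
      using assms(1) by (intro measurable_restrict_space1 measurable_completion) simp
    then show ?thesis
      by (intro integrable_const_bound[where B = B] AE_I2 assms(2))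
  qed
  show "integrable I01 f" by (rule *) simp
  then have "(LINT x|I01. f x) = integral {0<..<1} f"
    by (rule lebesgue_integral_eq_integral) simp
  then show "(LINT x|I01. f x) = integral {0..1} f"
    by (simp add: integral_open_interval_real)
  show "f integrable_on {a..b}"
    using *[of "{a..b}"] by (simp add: integrable_on_lebesgue_on)
qed

text \<open>The reflection x -> 2 - x carries [0,1] to [1,2]; from there on, translation by 2 does
  the rest, hence the induction in steps of two.\<close>

lemma integral_even_periodic:
  fixes h :: "real \<Rightarrow> real"
  assumes int: "\<And>a b. h integrable_on {a..b}"
    and even: "\<And>x. h (- x) = h x" and per: "\<And>x. h (x + 2) = h x"
  shows "integral {real k .. real k + 1} h = integral {0..1} h"
proof (induction k rule: induct_nat_012)
  case 0 show ?case by simp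
next
  case 1
  have *: "(h has_integral integral {0..1} h) {0..1}"
    using int by (simp add: integrable_integral)
  have "((\<lambda>x. h ((-1) *\<^sub>R x + 2)) has_integral (1 / \<bar>-1\<bar> ^ DIM(real)) *\<^sub>R integral {0..1} h)
     ((\<lambda>x. (1 / -1) *\<^sub>R x + -((1 / -1) *\<^sub>R 2)) ` cbox 0 (1::real))"
    by (rule has_integral_affinity) (use * in auto)
  moreover have "(\<lambda>x. (1 / -1) *\<^sub>R x + -((1 / -1) *\<^sub>R 2)) ` cbox 0 (1::real) = {1..2}"
  proof -
    have "(\<lambda>x. (1 / -1) *\<^sub>R x + -((1 / -1) *\<^sub>R 2)) = (\<lambda>x::real. 2 - x)" by auto
    then show ?thesis by (simp add: image_diff_atLeastAtMost)
  qed
  moreover have "h ((-1) *\<^sub>R x + 2) = h x" for x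
    using even[of x] per[of "-x"] by simp
  ultimately have "(h has_integral integral {0..1} h) {1..2}" by simp
  then show ?case by (simp add: integral_unique)
next
  case (ge2 k)
  have "((\<lambda>x. h (1 *\<^sub>R x + (-2))) has_integral (1 / \<bar>1\<bar> ^ DIM(real)) *\<^sub>R integral {real k..real k + 1} h)
     ((\<lambda>x. (1 / 1) *\<^sub>R x + -((1 / 1) *\<^sub>R (-2))) ` cbox (real k) (real k + 1))"
    by (rule has_integral_affinity) (use int in \<open>auto simp: integrable_integral\<close>)
  moreover have "h (x - 2) = h x" for x using per[of "x-2"] by simp
  ultimately have "(h has_integral integral {real k..real k + 1} h) ((\<lambda>x. x + 2) ` {real k .. real k + 1})"
    by simp
  moreover have "(\<lambda>x. x + 2) ` {real k .. real k + 1} = {real (Suc (Suc k)) .. real (Suc (Suc k)) + 1}"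
    by (simp add: image_add_atLeastAtMost' add.commute)
  ultimately have "(h has_integral integral {real k..real k + 1} h) {real (Suc (Suc k)) .. real (Suc (Suc k)) + 1}"
    by metis
  then show ?case using ge2.IH(1) by (metis integral_unique)
qed

text \<open>Substituting y = kx gives 1/k times the integral over [0,k], which consists of k unit
  intervals with equal integrals.\<close>

lemma integral_even_periodic_dilation:
  fixes h :: "real \<Rightarrow> real"
  assumes int: "\<And>a b. h integrable_on {a..b}"
    and even: "\<And>x. h (- x) = h x" and per: "\<And>x. h (x + 2) = h x" and k: "k > 0"
  shows "integral {0..1} (\<lambda>x. h (real k * x)) = integral {0..1} h"
proof -
  have sum: "integral {0..real n} h = real n * integral {0..1} h" for n
  proof (induction n)
    case (Suc n)
    have "integral {0..real (Suc n)} h = integral {0..real n} h + integral {real n..real (Suc n)} h"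
      by (rule Henstock_Kurzweil_Integration.integral_combine[symmetric]) (auto intro: int)
    then show ?case using Suc integral_even_periodic[of h n, OF assms(1-3)]
      by (simp add: algebra_simps)
  qed simp
  have "((\<lambda>x. h (real k *\<^sub>R x + 0)) has_integral (1 / \<bar>real k\<bar> ^ DIM(real)) *\<^sub>R integral {0..real k} h)
     ((\<lambda>x. (1 / real k) *\<^sub>R x + -((1 / real k) *\<^sub>R 0)) ` cbox 0 (real k))"
    by (rule has_integral_affinity) (use int k in \<open>auto simp: integrable_integral\<close>)
  moreover have "(\<lambda>x. (1 / real k) *\<^sub>R x + -((1 / real k) *\<^sub>R 0)) ` cbox 0 (real k) = {0..1}"
    using k by (simp add: image_divide_atLeastAtMost)
  ultimately have "((\<lambda>x. h (real k * x)) has_integral integral {0..1} h) {0..1}"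
    using k by (simp add: sum)
  then show ?thesis by (rule integral_unique)
qed

lemma nrm_dil:
  assumes "f \<in> periodic_odd" "k > 0"
  shows "nrm (dil k f) = nrm f"
proof -
  have [measurable]: "f \<in> borel_measurable borel" using assms by (simp add: periodic_odd_measurable)
  obtain B where B: "\<And>x. norm (f x) \<le> B" using assms periodic_odd_bounded by metis
  let ?h = "\<lambda>x. (norm (f x))^2"
  have B': "norm (?h x) \<le> B^2" for x using B by (simp add: power_mono)
  have m: "?h \<in> borel_measurable borel" by measurable
  have m': "(\<lambda>x. ?h (real k * x)) \<in> borel_measurable borel" by measurable
  have "(LINT x|I01. (norm (dil k f x))^2) = integral {0..1} (\<lambda>x. ?h (real k * x))"
    using LINT_I01_eq_integral(2)[OF m' B'] by (simp add: dil_def)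
  also have "\<dots> = integral {0..1} ?h"
    by (rule integral_even_periodic_dilation)
       (use assms LINT_I01_eq_integral(3)[OF m B'] in \<open>auto simp: periodic_odd_def\<close>)
  also have "\<dots> = (LINT x|I01. ?h x)"
    using LINT_I01_eq_integral(2)[OF m B'] by simp
  finally show ?thesis by (simp add: nrm_def)
qed

lemma nrm_sum:
  assumes "\<And>i. i \<in> I \<Longrightarrow> f i \<in> periodic_odd"
  shows "nrm (\<lambda>x. \<Sum>i\<in>I. f i x) \<le> (\<Sum>i\<in>I. nrm (f i))"
  using assms
proof (induction I rule: infinite_finite_induct)
  case (insert i I)
  have "nrm (\<lambda>x. f i x + (\<Sum>i\<in>I. f i x)) \<le> nrm (f i) + nrm (\<lambda>x. \<Sum>i\<in>I. f i x)"
    using insert.prems by (intro nrm_triangle periodic_odd_L2 periodic_odd_sum) auto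
  then show ?case using insert by force
qed (simp_all add: nrm_def)

text \<open>The jumps of the step functions in question are rational, and the rationals are a null
  set.\<close>

lemma nrm_eq_0_ae:
  assumes "\<And>x. 0 < x \<Longrightarrow> x < 1 \<Longrightarrow> x \<notin> \<rat> \<Longrightarrow> f x = g x"
  shows "nrm (\<lambda>x. f x - g x) = 0"
proof -
  have "AE x in lebesgue. x \<notin> (\<rat> :: real set)"
    by (intro AE_not_in null_sets_completionI countable_imp_null_set_lborel countable_rat)
  then have "AE x in I01. f x - g x = 0"
    using assms by (simp add: AE_restrict_space_iff) auto
  then have "(LINT x|I01. (norm (f x - g x))^2) = 0"
    by (intro integral_eq_zero_AE) auto
  then show ?thesis by (simp add: nrm_def)
qed

section \<open>Sine coefficients\<close>

lemma odd_ext_alt: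
  "odd_ext f x = (let y = 2 * frac (x / 2) in
      if 0 < y \<and> y < 1 then f y
      else if 1 < y \<and> y < 2 then - f (2 - y) else 0)"
  by (simp add: odd_ext_def frac_def algebra_simps)

lemma odd_ext_minus: "odd_ext f (- x) = - odd_ext f x"
proof (cases "x / 2 \<in> \<int>")
  case True
  then have *: "frac (x / 2) = 0" "frac (- x / 2) = 0" by (auto simp: frac_eq_0_iff)
  have "odd_ext f x = 0" "odd_ext f (- x) = 0"
    unfolding odd_ext_alt * by simp_all
  then show ?thesis by simp
next
  case False
  define z where "z = frac (x / 2)"
  have "frac (- (x / 2)) = 1 - z" using False by (simp add: frac_neg z_def)
  then have "odd_ext f (- x) = (let y = 2 - 2 * z in
      if 0 < y \<and> y < 1 then f y
      else if 1 < y \<and> y < 2 then - f (2 - y) else 0)" by (simp add: odd_ext_alt)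
  moreover have "odd_ext f x = (let y = 2 * z in
      if 0 < y \<and> y < 1 then f y
      else if 1 < y \<and> y < 2 then - f (2 - y) else 0)" by (simp add: odd_ext_alt z_def)
  ultimately show ?thesis by (auto simp: Let_def)
qed

lemma odd_ext_period: "odd_ext f (x + 2) = odd_ext f x"
proof -
  have "frac ((x + 2) / 2) = frac (x / 2)"
    using frac_1_eq[of "x / 2"] by (simp add: add_divide_distrib)
  then show ?thesis by (simp add: odd_ext_alt)
qed

lemma odd_ext_eq: "0 < x \<Longrightarrow> x < 1 \<Longrightarrow> odd_ext f x = f x"
  by (simp add: odd_ext_def floor_eq_iff[of x] floor_unique[of 0 "x/2"])

lemma periodic_odd_odd_ext:
  assumes [measurable]: "f \<in> borel_measurable borel" and B: "\<And>x. norm (f x) \<le> B"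
  shows "odd_ext f \<in> periodic_odd"
proof (rule periodic_oddI[where B = B])
  show "odd_ext f \<in> borel_measurable borel"
    unfolding odd_ext_def Let_def by measurable
  have "B \<ge> 0" using B[of 0] norm_ge_zero order_trans by blast
  then show "norm (odd_ext f x) \<le> B" for x
    using B by (auto simp: odd_ext_def Let_def)
qed (simp_all add: odd_ext_minus odd_ext_period)

text \<open>An even translation moves x into (0,2), and y -> 2 - y moves (1,2) to (0,1).
  Irrationality keeps y off the points 0 and 1, where \<open>odd_ext\<close> is set to 0 regardless
  of f.\<close>

lemma odd_ext_unique:
  assumes eq: "\<And>x. 0 < x \<Longrightarrow> x < 1 \<Longrightarrow> x \<notin> \<rat> \<Longrightarrow> f x = g x"
    and odd: "\<And>x. g (- x) = - g x" and per: "\<And>x. g (x + 2) = g x"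
    and x: "x \<notin> \<rat>"
  shows "odd_ext f x = g x"
proof -
  define y where "y = x - 2 * of_int \<lfloor>x / 2\<rfloor>"
  have gy: "g y = g x"
    using periodic_int[where f = g and x = y and k = "\<lfloor>x / 2\<rfloor>", OF per] by (simp add: y_def)
  have yq: "y \<notin> \<rat>"
  proof
    assume "y \<in> \<rat>"
    then have "y + 2 * of_int \<lfloor>x / 2\<rfloor> \<in> \<rat>" by (intro Rats_add Rats_mult) auto
    then show False using x by (simp add: y_def)
  qed
  have "y \<noteq> 0" "y \<noteq> 1" using yq by auto
  moreover have "0 \<le> y" "y < 2" unfolding y_def by linarith+
  ultimately consider "0 < y" "y < 1" | "1 < y" "y < 2" by linarith
  then show ?thesis
  proof cases
    case 1 then show ?thesis using eq[of y] yq gy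
      unfolding odd_ext_def by (simp add: y_def[symmetric])
  next
    case 2
    have "2 - y \<notin> \<rat>"
      using yq Rats_diff[of 2 "2 - y"] by auto
    then have "f (2 - y) = g (2 - y)" using eq[of "2 - y"] 2 by auto
    also have "\<dots> = - g y" using odd[of y] per[of "-y"] by (simp add: algebra_simps)
    finally show ?thesis using 2 gy
      unfolding odd_ext_def by (simp add: y_def[symmetric])
  qed
qed

section \<open>Orthogonality of the sines and the best approximation property\<close>

lemma has_integral_cos_pi_int:
  fixes n :: int
  assumes "n \<noteq> 0"
  shows "((\<lambda>x. cos (pi * of_int n * x)) has_integral 0) {0..1}"
proof -
  have "((\<lambda>x. cos (pi * of_int n * x)) has_integral
     (sin (pi * of_int n * 1) / (pi * of_int n) - sin (pi * of_int n * 0) / (pi * of_int n))) {0..1}"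
    using assms by (intro fundamental_theorem_of_calculus)
      (auto intro!: derivative_eq_intros simp flip: has_real_derivative_iff_has_vector_derivative)
  moreover have "sin (pi * of_int n) = 0" using sin_integer_2pi sin_zero_iff_int2 by (metis mult.commute)
  ultimately show ?thesis by simp
qed

lemma integral_sin_mult_sin:
  assumes "j > 0" "k > 0"
  shows "integral {0..1} (\<lambda>x. sin (pi * (real j * x)) * sin (pi * (real k * x))) = (if j = k then 1/2 else 0)"
proof -
  let ?a = "int j - int k" and ?b = "int j + int k"
  have eq: "sin (pi * (real j * x)) * sin (pi * (real k * x)) =
      (cos (pi * of_int ?a * x) - cos (pi * of_int ?b * x)) / 2" for x
    by (simp add: sin_times_sin algebra_simps)
  have b: "((\<lambda>x. cos (pi * of_int ?b * x)) has_integral 0) {0..1}"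
    using assms by (intro has_integral_cos_pi_int) auto
  have a: "((\<lambda>x. cos (pi * of_int ?a * x)) has_integral (if j = k then 1 else 0)) {0..1}"
    using has_integral_cos_pi_int[of ?a] has_integral_const_real[of "1::real" 0 1] by auto
  have "((\<lambda>x. (cos (pi * of_int ?a * x) - cos (pi * of_int ?b * x)) / 2) has_integral
      ((if j = k then 1 else 0) - 0) / 2) {0..1}"
    by (intro has_integral_divide has_integral_diff a b)
  also have "((if j = k then 1 else 0) - 0) / 2 = (if j = k then 1/2 else (0::real))" by simp
  finally show ?thesis unfolding eq by (rule integral_unique)
qed

text \<open>The factor 2 compensates for the sines having squared norm 1/2 on (0,1).\<close>

definition coef :: "(real \<Rightarrow> complex) \<Rightarrow> nat \<Rightarrow> complex" where
  "coef f k = 2 * (LINT x|I01. f x * sn k x)"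

lemma integrable_mult_sn:
  assumes "f \<in> periodic_odd"
  shows "integrable I01 (\<lambda>x. f x * sn k x)"
proof -
  have [measurable]: "f \<in> borel_measurable borel" "sn k \<in> borel_measurable borel"
    using assms periodic_odd_sn by (simp_all add: periodic_odd_measurable)
  obtain B where B: "\<And>x. norm (f x) \<le> B" "B \<ge> 0" using assms periodic_odd_bounded by metis
  show ?thesis
  proof (rule LINT_I01_eq_integral(1))
    show "norm (f x * sn k x) \<le> B" for x
      using mult_mono[OF B(1)[of x], of "norm (sn k x)" 1] B(2) by (simp add: norm_mult sn_def)
  qed measurable
qed

lemma coef_diff_scale:
  assumes "f \<in> periodic_odd" "g \<in> periodic_odd"
  shows "coef (\<lambda>x. f x - c * g x) k = coef f k - c * coef g k"
proof -
  have "(LINT x|I01. (f x - c * g x) * sn k x) = (LINT x|I01. f x * sn k x - c * (g x * sn k x))"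
    by (simp add: algebra_simps)
  also have "\<dots> = (LINT x|I01. f x * sn k x) - c * (LINT x|I01. g x * sn k x)"
    using integrable_mult_sn[OF assms(1), of k] integrable_mult_sn[OF assms(2), of k] by simp
  finally show ?thesis unfolding coef_def by (simp only: right_diff_distrib mult.left_commute)
qed

lemma LINT_sn_mult_sn:
  assumes "j > 0" "k > 0"
  shows "(LINT x|I01. sin (pi * (real j * x)) * sin (pi * (real k * x))) = (if j = k then 1/2 else 0)"
proof (subst LINT_I01_eq_integral(2)[where B = 1])
  show "norm (sin (pi * (real j * x)) * sin (pi * (real k * x))) \<le> 1" for x
    using mult_mono[of "\<bar>sin (pi * (real j * x))\<bar>" 1 "\<bar>sin (pi * (real k * x))\<bar>" 1] by (simp add: abs_mult)
qed (use integral_sin_mult_sin[OF assms] in auto)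

lemma coef_sn:
  assumes "j > 0" "k > 0"
  shows "coef (sn j) k = (if j = k then 1 else 0)"
proof -
  have "(LINT x|I01. sn j x * sn k x) =
      complex_of_real (LINT x|I01. sin (pi * (real j * x)) * sin (pi * (real k * x)))"
    unfolding sn_def of_real_mult[symmetric] by (rule integral_complex_of_real)
  then show ?thesis using LINT_sn_mult_sn[OF assms] by (simp add: coef_def)
qed

text \<open>Completing the square; in this form the error is visibly least at c =
  \<open>coef f k\<close>.\<close>

lemma nrm_sub_sn:
  assumes f: "f \<in> periodic_odd" and k: "k > 0"
  shows "(nrm (\<lambda>x. f x - c * sn k x))^2 = (nrm f)^2 + ((norm (c - coef f k))^2 - (norm (coef f k))^2) / 2"
proof -
  let ?s = "\<lambda>x. sin (pi * (real k * x))"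
  have eq: "(norm (f x - c * sn k x))^2 =
      (norm (f x))^2 - 2 * Re (cnj c * (f x * sn k x)) + (norm c)^2 * (?s x * ?s x)" for x
    unfolding cmod_power2 by (simp add: sn_def power2_eq_square algebra_simps)
  have i1: "integrable I01 (\<lambda>x. (norm (f x))^2)"
    using L2_01_integrable periodic_odd_L2 f by blast
  have i2: "integrable I01 (\<lambda>x. cnj c * (f x * sn k x))"
    using integrable_mult_sn[OF f] by (rule integrable_mult_right)
  define R where "R = (\<lambda>x. Re (cnj c * (f x * sn k x)))"
  have iR: "integrable I01 R"
    unfolding R_def using i2 by (rule integrable_Re)
  have i3: "integrable I01 (\<lambda>x. ?s x * ?s x)"
  proof (rule LINT_I01_eq_integral(1))
    show "norm (?s x * ?s x) \<le> 1" for x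
      using mult_mono[of "\<bar>?s x\<bar>" 1 "\<bar>?s x\<bar>" 1] by (simp add: abs_mult)
  qed measurable
  have "(nrm (\<lambda>x. f x - c * sn k x))^2 =
      (LINT x|I01. (norm (f x))^2 - 2 * R x + (norm c)^2 * (?s x * ?s x))"
    unfolding nrm_square eq R_def ..
  also have "\<dots> = (nrm f)^2 - 2 * (LINT x|I01. R x) + (norm c)^2 * (1 / 2)"
    using i1 iR i3 LINT_sn_mult_sn[OF k k] by (simp add: nrm_square)
  also have "(LINT x|I01. R x) = Re (cnj c * (LINT x|I01. f x * sn k x))"
    unfolding R_def integral_Re[OF i2] by (simp only: integral_mult_right_zero)
  also have "(LINT x|I01. f x * sn k x) = coef f k / 2" by (simp add: coef_def)
  finally show ?thesis
    unfolding cmod_power2 by (simp add: power2_eq_square field_simps)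
qed

definition sine_sum :: "nat set \<Rightarrow> (nat \<Rightarrow> complex) \<Rightarrow> real \<Rightarrow> complex" where
  "sine_sum K a x = (\<Sum>k\<in>K. a k * sn k x)"

lemma periodic_odd_sine_sum: "sine_sum K a \<in> periodic_odd"
  unfolding sine_sum_def by (intro periodic_odd_sum periodic_odd_scale periodic_odd_sn)

text \<open>The second conjunct carries the induction: by orthogonality, subtracting the sines of K
  leaves the other coefficients alone, so each new index still meets the coefficient of
  \<open>f\<close> itself.\<close>

lemma nrm_sub_sine_sum:
  assumes f: "f \<in> periodic_odd" and "finite K" "0 \<notin> K"
  shows "(nrm (\<lambda>x. f x - sine_sum K a x))^2 =
      (nrm f)^2 + (\<Sum>k\<in>K. (norm (a k - coef f k))^2 - (norm (coef f k))^2) / 2 \<and>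
    (\<forall>k. k > 0 \<longrightarrow> k \<notin> K \<longrightarrow> coef (\<lambda>x. f x - sine_sum K a x) k = coef f k)"
  using assms(2,3)
proof (induction K rule: finite_induct)
  case empty then show ?case by (simp add: sine_sum_def)
next
  case (insert j K)
  define g where "g = (\<lambda>x. f x - sine_sum K a x)"
  have g: "g \<in> periodic_odd"
    unfolding g_def by (intro periodic_odd_diff f periodic_odd_sine_sum)
  have j: "j > 0" using insert by auto
  have IH: "(nrm g)^2 = (nrm f)^2 + (\<Sum>k\<in>K. (norm (a k - coef f k))^2 - (norm (coef f k))^2) / 2"
    "\<And>k. k > 0 \<Longrightarrow> k \<notin> K \<Longrightarrow> coef g k = coef f k"
    using insert by (auto simp: g_def)
  have eq: "(\<lambda>x. f x - sine_sum (insert j K) a x) = (\<lambda>x. g x - a j * sn j x)"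
    using insert by (auto simp: g_def sine_sum_def fun_eq_iff)
  have "coef (\<lambda>x. g x - a j * sn j x) k = coef f k" if "k > 0" "k \<notin> insert j K" for k
    using that j IH(2)[of k] by (subst coef_diff_scale[OF g periodic_odd_sn]) (auto simp: coef_sn)
  moreover have "(nrm (\<lambda>x. g x - a j * sn j x))^2 =
      (nrm f)^2 + (\<Sum>k\<in>insert j K. (norm (a k - coef f k))^2 - (norm (coef f k))^2) / 2"
    unfolding nrm_sub_sn[OF g j] using IH(1) IH(2)[OF j] insert by (simp add: field_simps)
  ultimately show ?case unfolding eq by auto
qed

lemma nrm_sine_sum:
  assumes "finite K" "0 \<notin> K"
  shows "(nrm (sine_sum K a))^2 = (\<Sum>k\<in>K. (norm (a k))^2) / 2"
proof -
  have "coef (\<lambda>x. 0) k = 0" for k by (simp add: coef_def)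
  moreover have "nrm (\<lambda>x. 0) = 0" by (simp add: nrm_def)
  moreover have "nrm (\<lambda>x. 0 - sine_sum K a x) = nrm (sine_sum K a)" by (simp add: nrm_def)
  ultimately show ?thesis
    using nrm_sub_sine_sum[OF periodic_odd_zero assms, of a] by simp
qed

section \<open>Density of sine polynomials\<close>

lemma nrm_tendsto_0_dominated:
  assumes [measurable]: "f \<in> borel_measurable I01" "\<And>n::nat. g n \<in> borel_measurable I01"
    and w: "integrable I01 w"
    and le: "\<And>n x. x \<in> {0<..<1} \<Longrightarrow> (norm (f x - g n x))^2 \<le> w x"
    and lim: "AE x in I01. (\<lambda>n. g n x) \<longlonglongrightarrow> f x"
  shows "(\<lambda>n. nrm (\<lambda>x. f x - g n x)) \<longlonglongrightarrow> 0"
proof -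
  have "(\<lambda>n. LINT x|I01. (norm (f x - g n x))^2) \<longlonglongrightarrow> (LINT x|I01. 0)"
  proof (rule integral_dominated_convergence[OF _ _ w])
    show "AE x in I01. (\<lambda>n. (norm (f x - g n x))^2) \<longlonglongrightarrow> 0"
      using lim
    proof eventually_elim
      fix x assume "(\<lambda>n. g n x) \<longlonglongrightarrow> f x"
      then have "(\<lambda>n. (norm (f x - g n x))^2) \<longlonglongrightarrow> (norm (f x - f x))^2"
        by (intro tendsto_intros)
      then show "(\<lambda>n. (norm (f x - g n x))^2) \<longlonglongrightarrow> 0" by simp
    qed
    show "AE x in I01. norm ((norm (f x - g n x))^2) \<le> w x" for n
      using le by (intro AE_I2) (simp add: space_restrict_space)
  qed measurable
  then have "(\<lambda>n. sqrt (LINT x|I01. (norm (f x - g n x))^2)) \<longlonglongrightarrow> sqrt 0"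
    by (intro tendsto_real_sqrt) simp
  then show ?thesis by (simp add: nrm_def)
qed

definition sine_poly :: "(real \<Rightarrow> complex) \<Rightarrow> bool" where
  "sine_poly f \<longleftrightarrow> (\<exists>N a. f = sine_sum {1..N} a)"

lemma sine_sum_pad:
  assumes "N \<le> M"
  shows "sine_sum {1..N} a = sine_sum {1..M} (\<lambda>k. if k \<le> N then a k else 0)"
proof
  fix x
  show "sine_sum {1..N} a x = sine_sum {1..M} (\<lambda>k. if k \<le> N then a k else 0) x"
    unfolding sine_sum_def using assms by (intro sum.mono_neutral_cong_left) auto
qed

lemma sine_poly_periodic_odd: "sine_poly f \<Longrightarrow> f \<in> periodic_odd"
  by (auto simp: sine_poly_def periodic_odd_sine_sum)

lemma sine_poly_add:
  assumes "sine_poly f" "sine_poly g"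
  shows "sine_poly (\<lambda>x. f x + g x)"
proof -
  obtain N a M b where fg: "f = sine_sum {1..N} a" "g = sine_sum {1..M} b"
    using assms by (auto simp: sine_poly_def)
  have "(\<lambda>x. f x + g x) = sine_sum {1..max N M}
      (\<lambda>k. (if k \<le> N then a k else 0) + (if k \<le> M then b k else 0))"
    unfolding fg sine_sum_pad[of N "max N M" a, OF max.cobounded1]
      sine_sum_pad[of M "max N M" b, OF max.cobounded2]
    by (simp add: fun_eq_iff sine_sum_def sum.distrib distrib_right)
  then show ?thesis unfolding sine_poly_def by blast
qed

lemma sine_poly_scale:
  assumes "sine_poly f"
  shows "sine_poly (\<lambda>x. c * f x)"
proof -
  obtain N a where f: "f = sine_sum {1..N} a"
    using assms by (auto simp: sine_poly_def)
  have "(\<lambda>x. c * f x) = sine_sum {1..N} (\<lambda>k. c * a k)"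
    by (auto simp: f sine_sum_def sum_distrib_left mult_ac)
  then show ?thesis unfolding sine_poly_def by blast
qed

lemma sine_poly_sn: "sine_poly (sn k)"
proof -
  have "sn k = sine_sum {1..k} (\<lambda>j. if j = k then 1 else 0)"
    by (cases "k = 0") (auto simp: sine_sum_def sn_def fun_eq_iff if_distrib[of "\<lambda>x. x * _"] sum.delta cong: if_cong)
  then show ?thesis unfolding sine_poly_def by blast
qed

lemma sine_poly_sum:
  assumes "\<And>i. i \<in> I \<Longrightarrow> sine_poly (f i)"
  shows "sine_poly (\<lambda>x. \<Sum>i\<in>I. f i x)"
proof -
  have "sine_poly (\<lambda>x. 0)" using sine_poly_scale[OF sine_poly_sn, of 0] by simp
  then show ?thesis using assms
    by (induction I rule: infinite_finite_induct) (auto intro: sine_poly_add)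
qed

text \<open>sin(kt) cos(t) is the mean of sin((k+1)t) and sin((k-1)t). For k = 1 the second index is
  0, which \<open>sine_poly_sn\<close> admits because \<open>sn 0\<close> vanishes.\<close>

lemma sine_poly_mult_cos:
  assumes "sine_poly f"
  shows "sine_poly (\<lambda>x. f x * complex_of_real (cos (pi * x)))"
proof -
  obtain N a where f: "f = sine_sum {1..N} a"
    using assms by (auto simp: sine_poly_def)
  have eq: "sn k x * complex_of_real (cos (pi * x)) = 1/2 * (sn (k + 1) x + sn (k - 1) x)"
    if "k \<ge> 1" for k x
  proof -
    have "sin (pi * (real k * x)) * cos (pi * x) =
        (sin (pi * (real (k + 1) * x)) + sin (pi * (real (k - 1) * x))) / 2"
      using that sin_add[of "pi * (real k * x)" "pi * x"] sin_diff[of "pi * (real k * x)" "pi * x"]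
      by (simp add: algebra_simps of_nat_diff)
    from arg_cong[OF this, of complex_of_real] show ?thesis
      by (simp add: sn_def del: of_nat_diff of_nat_add)
  qed
  have "(\<lambda>x. f x * complex_of_real (cos (pi * x))) =
      (\<lambda>x. \<Sum>k\<in>{1..N}. a k * (1/2 * (sn (k + 1) x + sn (k - 1) x)))"
    by (auto simp: f sine_sum_def sum_distrib_right mult.assoc eq intro!: sum.cong)
  moreover have "sine_poly (\<lambda>x. \<Sum>k\<in>{1..N}. a k * (1/2 * (sn (k + 1) x + sn (k - 1) x)))"
    by (intro sine_poly_sum sine_poly_scale sine_poly_add sine_poly_sn)
  ultimately show ?thesis by metis
qed

lemma sine_poly_mult_polynomial:
  assumes "real_polynomial_function p"
  shows "sine_poly (\<lambda>x. sn 1 x * complex_of_real (p (cos (pi * x))))"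
proof -
  have pow: "sine_poly (\<lambda>x. sn 1 x * complex_of_real (cos (pi * x)) ^ i)" for i
  proof (induction i)
    case 0 then show ?case by (simp add: sine_poly_sn)
  next
    case (Suc i)
    then show ?case using sine_poly_mult_cos[OF Suc] by (simp add: mult_ac)
  qed
  obtain a and n :: nat where "p = (\<lambda>x. \<Sum>i\<le>n. a i * x ^ i)"
    using real_polynomial_function_imp_sum[OF assms] by blast
  then have "(\<lambda>x. sn 1 x * complex_of_real (p (cos (pi * x)))) =
      (\<lambda>x. \<Sum>i\<in>{..n}. complex_of_real (a i) * (sn 1 x * complex_of_real (cos (pi * x)) ^ i))"
    by (auto simp: fun_eq_iff sum_distrib_left mult_ac)
  then show ?thesis by (auto intro!: sine_poly_sum sine_poly_scale pow simp del: One_nat_def)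
qed

definition sine_limit :: "(real \<Rightarrow> complex) \<Rightarrow> bool" where
  "sine_limit f \<longleftrightarrow> (\<forall>e>0. \<exists>p. sine_poly p \<and> nrm (\<lambda>x. f x - p x) < e)"

lemma sine_limit_closed:
  assumes f: "f \<in> L2_01" and g: "\<And>n. g n \<in> L2_01" "\<And>n. sine_limit (g n)"
    and lim: "(\<lambda>n::nat. nrm (\<lambda>x. f x - g n x)) \<longlonglongrightarrow> 0"
  shows "sine_limit f"
  unfolding sine_limit_def
proof (intro allI impI)
  fix e :: real assume "e > 0"
  then obtain n where n: "nrm (\<lambda>x. f x - g n x) < e/2"
    using LIMSEQ_D[OF lim, of "e/2"] by auto
  obtain p where p: "sine_poly p" "nrm (\<lambda>x. g n x - p x) < e/2"
    using g(2)[of n] \<open>e > 0\<close> unfolding sine_limit_def by (meson half_gt_zero)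
  have "nrm (\<lambda>x. f x - p x) \<le> nrm (\<lambda>x. f x - g n x) + nrm (\<lambda>x. g n x - p x)"
    by (intro nrm_triangle3 f g periodic_odd_L2 sine_poly_periodic_odd p)
  then show "\<exists>p. sine_poly p \<and> nrm (\<lambda>x. f x - p x) < e" using n p by force
qed

lemma norm_sn_le: "norm (sn k x) \<le> 1"
  by (simp add: sn_def)

lemma sn_measurable [measurable]: "sn k \<in> borel_measurable borel"
  by (simp add: periodic_odd_sn periodic_odd_measurable)

text \<open>Since t = cos(pi x) maps [0,1] homeomorphically onto [-1,1], h is a continuous function
  of t and Weierstrass supplies polynomials in cos(pi x), separately for real and imaginary part.
  The factor sin(pi x) turns these into sine polynomials.\<close>

lemma sine_limit_sn_mult_continuous:
  assumes "continuous_on {0..1} h"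
  shows "sine_limit (\<lambda>x. sn 1 x * h x)"
  unfolding sine_limit_def
proof (intro allI impI)
  fix e :: real assume "e > 0"
  have cont: "continuous_on {-1..1} (\<lambda>t. h (arccos t / pi))"
  proof (rule continuous_on_compose2[OF assms])
    show "continuous_on {- 1..1} (\<lambda>t. arccos t / pi)"
      by (intro continuous_intros) auto
    show "(\<lambda>t. arccos t / pi) ` {- 1..1} \<subseteq> {0..1}"
      by (auto simp: arccos_lbound arccos_ubound)
  qed
  obtain p where p: "real_polynomial_function p"
      "\<And>t. t \<in> {-1..1} \<Longrightarrow> \<bar>Re (h (arccos t / pi)) - p t\<bar> < e/4"
    by (rule Stone_Weierstrass_real_polynomial_function[of "{-1..1}" "\<lambda>t. Re (h (arccos t / pi))" "e/4"])
       (use cont \<open>e > 0\<close> in \<open>auto intro!: continuous_on_Re\<close>)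
  obtain r where r: "real_polynomial_function r"
      "\<And>t. t \<in> {-1..1} \<Longrightarrow> \<bar>Im (h (arccos t / pi)) - r t\<bar> < e/4"
    by (rule Stone_Weierstrass_real_polynomial_function[of "{-1..1}" "\<lambda>t. Im (h (arccos t / pi))" "e/4"])
       (use cont \<open>e > 0\<close> in \<open>auto intro!: continuous_on_Im\<close>)
  define s where "s = (\<lambda>x. sn 1 x * complex_of_real (p (cos (pi * x))) +
      \<i> * (sn 1 x * complex_of_real (r (cos (pi * x)))))"
  have s: "sine_poly s"
    unfolding s_def by (intro sine_poly_add sine_poly_scale sine_poly_mult_polynomial p r)
  have le: "norm (sn 1 x * h x - s x) \<le> e/2" if "x \<in> {0<..<1}" for x
  proof -
    define t where "t = cos (pi * x)"
    have t: "t \<in> {-1..1}" "arccos t / pi = x"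
      using that by (auto simp: t_def arccos_cos)
    have "sn 1 x * h x - s x = sn 1 x * Complex (Re (h x) - p t) (Im (h x) - r t)"
      by (simp add: s_def t_def complex_eq_iff algebra_simps)
    also have "norm \<dots> \<le> 1 * norm (Complex (Re (h x) - p t) (Im (h x) - r t))"
      unfolding norm_mult by (intro mult_right_mono norm_sn_le) auto
    also have "\<dots> \<le> \<bar>Re (h x) - p t\<bar> + \<bar>Im (h x) - r t\<bar>"
      using cmod_le[of "Complex (Re (h x) - p t) (Im (h x) - r t)"] by simp
    also have "\<dots> \<le> e/2" using p(2)[OF t(1)] r(2)[OF t(1)] t(2) by simp
    finally show ?thesis .
  qed
  have "h \<in> borel_measurable (lebesgue_on {0..1})"
    by (rule continuous_imp_measurable_on_sets_lebesgue[OF assms]) auto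
  then have [measurable]: "h \<in> borel_measurable I01"
    by (rule measurable_restrict_mono) auto
  have [measurable]: "s \<in> borel_measurable borel"
    using s by (simp add: sine_poly_periodic_odd periodic_odd_measurable)
  have "nrm (\<lambda>x. sn 1 x * h x - s x) \<le> e/2"
    using \<open>e > 0\<close> by (intro nrm_le_bound le) auto
  then show "\<exists>p. sine_poly p \<and> nrm (\<lambda>x. sn 1 x * h x - p x) < e"
    using s \<open>e > 0\<close> by (intro exI[of _ s]) auto
qed

lemma sn_1_pos: "x \<in> {0<..<1} \<Longrightarrow> norm (sn 1 x) > 0"
  using sin_gt_zero[of "pi * x"] by (auto simp: sn_def)

text \<open>Approximating $f / \sin(\pi x)$ instead of $f$ makes the continuous approximants vanish at the endpoints.\<close>

lemma sine_limit_dominated_by_sn: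
  assumes f [measurable]: "f \<in> borel_measurable I01"
    and B: "B > 0" "\<And>x. x \<in> {0<..<1} \<Longrightarrow> norm (f x) \<le> B * norm (sn 1 x)"
  shows "sine_limit f"
proof -
  define h where "h = (\<lambda>x. f x / sn 1 x)"
  have "h \<in> borel_measurable I01"
    unfolding h_def by measurable
  then have "h measurable_on {0<..<1}"
    by (subst measurable_on_iff_borel_measurable) auto
  then obtain N g where N: "negligible N" and g: "\<And>n. continuous_on UNIV (g n)"
      and lim: "\<And>x. x \<notin> N \<Longrightarrow> (\<lambda>n. g n x) \<longlonglongrightarrow> (if x \<in> {0<..<1} then h x else 0)"
    unfolding measurable_on_def by blast
  \<comment> \<open>Radial retraction onto the disc of radius B. It gives the approximants a common
    bound for dominated convergence and, being continuous and fixing the values of \<open>h\<close>,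
    leaves the limit unchanged.\<close>
  define clip :: "complex \<Rightarrow> complex" where "clip z = z * complex_of_real (B / max B (norm z))" for z
  have "continuous_on UNIV clip"
    unfolding clip_def using B(1) by (intro continuous_intros) auto
  have clip_le: "norm (clip z) \<le> B" for z
    using B(1) by (simp add: clip_def norm_mult norm_divide field_simps max_def)
  define G where "G = (\<lambda>n x. sn 1 x * clip (g n x))"
  have contG: "continuous_on UNIV (\<lambda>x. clip (g n x))" for n
    by (rule continuous_on_compose2[OF \<open>continuous_on UNIV clip\<close> g]) auto
  have [measurable]: "(\<lambda>x. clip (g n x)) \<in> borel_measurable borel" for n
    using contG by (rule borel_measurable_continuous_onI)
  have G_le: "norm (G n x) \<le> B" for n x
    using mult_mono[OF norm_sn_le[of 1 x] clip_le[of "g n x"]] by (simp add: G_def norm_mult)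
  have f_le: "norm (f x) \<le> B" if "x \<in> {0<..<1}" for x
    using order.trans[OF B(2)[OF that] mult_left_mono[OF norm_sn_le]] B(1) by simp
  have G [measurable]: "G n \<in> borel_measurable borel" for n
    unfolding G_def by measurable
  show ?thesis
  proof (rule sine_limit_closed)
    show "f \<in> L2_01" using f f_le by (rule bounded_in_L2_01)
    show "G n \<in> L2_01" for n using G_le by (intro bounded_in_L2_01) auto
    show "sine_limit (G n)" for n
      unfolding G_def by (intro sine_limit_sn_mult_continuous continuous_on_subset[OF contG]) auto
    show "(\<lambda>n. nrm (\<lambda>x. f x - G n x)) \<longlonglongrightarrow> 0"
    proof (rule nrm_tendsto_0_dominated)
      show "integrable I01 (\<lambda>x. (B + B)^2)"
        by (intro finite_measure.integrable_const finite_measure_lebesgue_on) simp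
      show "(norm (f x - G n x))^2 \<le> (B + B)^2" if "x \<in> {0<..<1}" for n x
        using f_le[OF that] G_le[of n x] by (intro power_mono order.trans[OF norm_triangle_ineq4] add_mono) auto
      have "AE x in lebesgue. x \<notin> N"
        using N by (intro AE_not_in) (simp add: negligible_iff_null_sets)
      then have "AE x in I01. x \<in> {0<..<1} \<and> x \<notin> N"
        by (auto simp: AE_restrict_space_iff elim!: eventually_mono)
      then show "AE x in I01. (\<lambda>n. G n x) \<longlonglongrightarrow> f x"
      proof eventually_elim
        fix x assume x: "x \<in> {0<..<1} \<and> x \<notin> N"
        then have "(\<lambda>n. g n x) \<longlonglongrightarrow> h x" using lim[of x] by simp
        then have "(\<lambda>n. clip (g n x)) \<longlonglongrightarrow> clip (h x)"
          by (rule continuous_on_tendsto_compose[OF \<open>continuous_on UNIV clip\<close>]) auto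
        then have "(\<lambda>n. G n x) \<longlonglongrightarrow> sn 1 x * clip (h x)"
          unfolding G_def by (intro tendsto_mult tendsto_const)
        moreover have "norm (h x) \<le> B"
          using B(2)[of x] x sn_1_pos[of x] by (simp add: h_def norm_divide field_simps)
        then have "clip (h x) = h x" using B(1) by (simp add: clip_def max_def)
        moreover have "sn 1 x * h x = f x" using sn_1_pos[of x] x by (auto simp: h_def)
        ultimately show "(\<lambda>n. G n x) \<longlonglongrightarrow> f x" by simp
      qed
    qed auto
  qed
qed

text \<open>Truncating f to the set where |f| <= (n+1) sin(pi x) reduces to the dominated case. As
  the sine is positive inside (0,1), the truncations are eventually equal to f at each point, and
  the errors are dominated by |f|^2.\<close>

theorem sine_limit_L2_01:
  assumes f: "f \<in> L2_01"
  shows "sine_limit f"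
proof -
  have [measurable]: "f \<in> borel_measurable I01" using f by (rule L2_01_measurable)
  define g where "g = (\<lambda>n x. if norm (f x) \<le> real (Suc n) * norm (sn 1 x) then f x else 0)"
  have g [measurable]: "g n \<in> borel_measurable I01" for n
    unfolding g_def by measurable
  have g_le: "norm (g n x) \<le> real (Suc n) * norm (sn 1 x)" for n x by (simp add: g_def)
  show ?thesis
  proof (rule sine_limit_closed[OF f])
    show "g n \<in> L2_01" for n
      using order.trans[OF g_le[of n] mult_left_mono[OF norm_sn_le[of 1]]]
      by (intro bounded_in_L2_01[OF g, of n "real (Suc n) * 1"]) auto
    show "sine_limit (g n)" for n
      by (rule sine_limit_dominated_by_sn[OF g, of "real (Suc n)"]) (use g_le in auto)
    show "(\<lambda>n. nrm (\<lambda>x. f x - g n x)) \<longlonglongrightarrow> 0"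
    proof (rule nrm_tendsto_0_dominated)
      show "integrable I01 (\<lambda>x. (norm (f x))^2)" using f by (rule L2_01_integrable)
      show "AE x in I01. (\<lambda>n. g n x) \<longlonglongrightarrow> f x"
      proof (rule AE_I2)
        fix x assume "x \<in> space I01"
        then have s: "norm (sn 1 x) > 0" by (intro sn_1_pos) (simp add: space_restrict_space)
        obtain n where n: "norm (f x) / norm (sn 1 x) < real n" using reals_Archimedean2 by blast
        have "g m x = f x" if "m \<ge> n" for m
        proof -
          have "norm (f x) \<le> real n * norm (sn 1 x)" using n s by (simp add: field_simps)
          also have "\<dots> \<le> real (Suc m) * norm (sn 1 x)"
            using that by (intro mult_right_mono) auto
          finally show ?thesis by (simp add: g_def)
        qed
        then show "(\<lambda>n. g n x) \<longlonglongrightarrow> f x"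
          by (intro tendsto_eventually) (auto simp: eventually_sequentially)
      qed
    qed (auto simp: g_def)
  qed
qed

section \<open>Dilation-invariant subspaces\<close>

text \<open>Convergence of the sine series to f, with the sequence as data of its own. Subtraction
  and dilation then act directly on closed formulas for coefficients, without computing integrals
  again.\<close>

definition has_coeffs :: "(real \<Rightarrow> complex) \<Rightarrow> (nat \<Rightarrow> complex) \<Rightarrow> bool" where
  "has_coeffs f a \<longleftrightarrow> f \<in> periodic_odd \<and> (\<lambda>N. nrm (\<lambda>x. f x - sine_sum {1..N} a x)) \<longlonglongrightarrow> 0"

text \<open>Among sine sums up to M the one with the coefficients of f is nearest, so it does at
  least as well as any approximant provided by density, padded with zeros to length M.\<close>

lemma has_coeffs_coef:
  assumes f: "f \<in> periodic_odd"
  shows "has_coeffs f (coef f)"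
  unfolding has_coeffs_def
proof (intro conjI f LIMSEQ_I)
  fix e :: real assume "e > 0"
  have "sine_limit f" using f by (intro sine_limit_L2_01 periodic_odd_L2)
  then obtain N b where p: "nrm (\<lambda>x. f x - sine_sum {1..N} b x) < e"
    using \<open>e > 0\<close> unfolding sine_limit_def sine_poly_def by blast
  have "nrm (\<lambda>x. f x - sine_sum {1..M} (coef f) x) < e" if "M \<ge> N" for M
  proof -
    let ?b = "\<lambda>k. if k \<le> N then b k else 0"
    have "(nrm (\<lambda>x. f x - sine_sum {1..M} (coef f) x))^2 =
        (nrm f)^2 + (\<Sum>k\<in>{1..M}. (norm (coef f k - coef f k))^2 - (norm (coef f k))^2) / 2"
      using nrm_sub_sine_sum[OF f, of "{1..M}" "coef f"] by simp
    also have "\<dots> \<le> (nrm f)^2 + (\<Sum>k\<in>{1..M}. (norm (?b k - coef f k))^2 - (norm (coef f k))^2) / 2"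
      by (intro add_left_mono divide_right_mono sum_mono) auto
    also have "\<dots> = (nrm (\<lambda>x. f x - sine_sum {1..M} ?b x))^2"
      using nrm_sub_sine_sum[OF f, of "{1..M}" ?b] by simp
    also have "\<dots> = (nrm (\<lambda>x. f x - sine_sum {1..N} b x))^2"
      using sine_sum_pad[OF that, of b] by simp
    finally have "nrm (\<lambda>x. f x - sine_sum {1..M} (coef f) x) \<le> nrm (\<lambda>x. f x - sine_sum {1..N} b x)"
      by (rule power2_le_imp_le) simp
    then show ?thesis using p by simp
  qed
  then show "\<exists>N. \<forall>n\<ge>N. norm (nrm (\<lambda>x. f x - sine_sum {1..n} (coef f) x) - 0) < e"
    by auto
qed

lemma has_coeffs_sub_scale:
  assumes "has_coeffs f a" "has_coeffs g b"
  shows "has_coeffs (\<lambda>x. f x - c * g x) (\<lambda>k. a k - c * b k)"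
proof -
  have V: "f \<in> periodic_odd" "g \<in> periodic_odd" using assms by (auto simp: has_coeffs_def)
  let ?F = "\<lambda>N x. f x - sine_sum {1..N} a x" and ?G = "\<lambda>N x. g x - sine_sum {1..N} b x"
  have eq: "(\<lambda>x. (f x - c * g x) - sine_sum {1..N} (\<lambda>k. a k - c * b k) x) =
      (\<lambda>x. ?F N x + (- c) * ?G N x)" for N
    by (simp add: sine_sum_def fun_eq_iff left_diff_distrib right_diff_distrib sum_subtractf
        sum_distrib_left mult.assoc sum_negf)
  have "nrm (\<lambda>x. ?F N x + (- c) * ?G N x) \<le> nrm (?F N) + norm c * nrm (?G N)" for N
  proof -
    have "nrm (\<lambda>x. ?F N x + (- c) * ?G N x) \<le> nrm (?F N) + nrm (\<lambda>x. (- c) * ?G N x)"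
      by (intro nrm_triangle L2_01_scale L2_01_diff periodic_odd_L2 V periodic_odd_sine_sum)
    then show ?thesis by (simp only: nrm_scale norm_minus_cancel)
  qed
  moreover have "(\<lambda>N. nrm (?F N) + norm c * nrm (?G N)) \<longlonglongrightarrow> 0 + norm c * 0"
    using assms unfolding has_coeffs_def by (intro tendsto_intros) auto
  ultimately have "(\<lambda>N. nrm (\<lambda>x. ?F N x + (- c) * ?G N x)) \<longlonglongrightarrow> 0"
    by (intro Lim_null_comparison[where f = "\<lambda>N. nrm (\<lambda>x. ?F N x + (- c) * ?G N x)"]) auto
  then show ?thesis unfolding has_coeffs_def eq
    using V by (auto intro: periodic_odd_diff periodic_odd_scale)
qed

text \<open>The indices up to N divisible by p are exactly pj with 1 <= j <= N div p, so truncation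
  at N corresponds to truncation at N div p before dilating.\<close>

lemma sine_sum_dil:
  assumes "p > 0"
  shows "sine_sum {1..N} (\<lambda>k. if p dvd k then a (k div p) else 0) = dil p (sine_sum {1..N div p} a)"
proof
  fix x
  have "sine_sum {1..N} (\<lambda>k. if p dvd k then a (k div p) else 0) x =
      (\<Sum>k\<in>(*) p ` {1..N div p}. a (k div p) * sn k x)"
    unfolding sine_sum_def
  proof (rule sum.mono_neutral_cong_right)
    show "(*) p ` {1..N div p} \<subseteq> {1..N}"
    proof safe
      fix j assume "j \<in> {1..N div p}"
      then have "1 \<le> j" "p * j \<le> p * (N div p)" by auto
      moreover have "p * (N div p) \<le> N" by simp
      ultimately have "p * j \<le> N" "p * j > 0" using assms by (linarith, simp)
      then show "p * j \<in> {1..N}" by simp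
    qed
    show "\<forall>i\<in>{1..N} - (*) p ` {1..N div p}. (if p dvd i then a (i div p) else 0) * sn i x = 0"
    proof
      fix i assume i: "i \<in> {1..N} - (*) p ` {1..N div p}"
      have "\<not> p dvd i"
      proof
        assume "p dvd i"
        then obtain j where "i = p * j" by blast
        then have "j \<in> {1..N div p}" using i assms div_le_mono[of "p * j" N p]
          by (cases j) auto
        then show False using i \<open>i = p * j\<close> by blast
      qed
      then show "(if p dvd i then a (i div p) else 0) * sn i x = 0" by simp
    qed
  qed auto
  also have "\<dots> = (\<Sum>j\<in>{1..N div p}. a j * sn (p * j) x)"
    using assms by (subst sum.reindex) (auto simp: inj_on_def)
  also have "\<dots> = dil p (sine_sum {1..N div p} a) x"
    by (simp add: dil_def sine_sum_def sn_def mult_ac)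
  finally show "sine_sum {1..N} (\<lambda>k. if p dvd k then a (k div p) else 0) x =
      dil p (sine_sum {1..N div p} a) x" .
qed

lemma has_coeffs_dil:
  assumes f: "has_coeffs f a" and p: "p > 0"
  shows "has_coeffs (dil p f) (\<lambda>k. if p dvd k then a (k div p) else 0)"
proof -
  have V: "f \<in> periodic_odd" and lim: "(\<lambda>N. nrm (\<lambda>x. f x - sine_sum {1..N} a x)) \<longlonglongrightarrow> 0"
    using f by (auto simp: has_coeffs_def)
  have "nrm (\<lambda>x. dil p f x - dil p (sine_sum {1..n} a) x) = nrm (\<lambda>x. f x - sine_sum {1..n} a x)" for n
    using nrm_dil[OF periodic_odd_diff[OF V periodic_odd_sine_sum[of "{1..n}" a]] p]
    by (simp add: dil_def[abs_def])
  moreover have "filterlim (\<lambda>N. N div p) at_top at_top"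
    unfolding filterlim_at_top eventually_sequentially
  proof
    fix Z
    have "Z \<le> m div p" if "m \<ge> Z * p" for m
      using div_le_mono[OF that, of p] p by simp
    then show "\<exists>N. \<forall>m\<ge>N. Z \<le> m div p" by blast
  qed
  then have "(\<lambda>N. nrm (\<lambda>x. f x - sine_sum {1..N div p} a x)) \<longlonglongrightarrow> 0"
    by (rule filterlim_compose[OF lim])
  ultimately show ?thesis
    unfolding has_coeffs_def sine_sum_dil[OF p] using V by (simp add: periodic_odd_dil)
qed

text \<open>Parseval for the partial sums, followed by a limit; the 2 is again the squared norm 1/2
  of a sine.\<close>

lemma has_coeffs_nrm_le:
  assumes f: "has_coeffs f a" and B: "B \<ge> 0"
    and le: "\<And>N. (\<Sum>k\<in>{1..N}. (norm (a k))^2) \<le> 2 * B^2"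
  shows "nrm f \<le> B"
proof (rule field_le_epsilon)
  fix e :: real assume "e > 0"
  have V: "f \<in> periodic_odd" using f by (auto simp: has_coeffs_def)
  obtain N where N: "nrm (\<lambda>x. f x - sine_sum {1..N} a x) < e"
    using LIMSEQ_D[of _ "0::real" e] f \<open>e > 0\<close> unfolding has_coeffs_def by fastforce
  have "(nrm (sine_sum {1..N} a))^2 \<le> B^2"
    using le[of N] by (subst nrm_sine_sum) auto
  then have "nrm (sine_sum {1..N} a) \<le> B" using B power2_le_imp_le by blast
  moreover have "nrm (\<lambda>x. (f x - sine_sum {1..N} a x) + sine_sum {1..N} a x) \<le>
      nrm (\<lambda>x. f x - sine_sum {1..N} a x) + nrm (sine_sum {1..N} a)"
    by (intro nrm_triangle periodic_odd_L2 periodic_odd_diff V periodic_odd_sine_sum)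
  ultimately show "nrm f \<le> B + e" using N by simp
qed

text \<open>Polynomials in dilations; the number bounds the sum of the absolute values of the coefficients.\<close>

inductive dil_op :: "((real \<Rightarrow> complex) \<Rightarrow> real \<Rightarrow> complex) \<Rightarrow> real \<Rightarrow> bool" where
  zero: "dil_op (\<lambda>f x. 0) 0"
| ident: "dil_op (\<lambda>f. f) 1"
| dil: "dil_op A r \<Longrightarrow> k > 0 \<Longrightarrow> dil_op (\<lambda>f. dil k (A f)) r"
| add_scale: "dil_op A r \<Longrightarrow> dil_op B s \<Longrightarrow> dil_op (\<lambda>f x. A f x + c * B f x) (r + norm c * s)"

lemma dil_op_nonneg: "dil_op A r \<Longrightarrow> r \<ge> 0"
  by (induction rule: dil_op.induct) auto

lemma dil_op_periodic_odd: "dil_op A r \<Longrightarrow> f \<in> periodic_odd \<Longrightarrow> A f \<in> periodic_odd"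
  by (induction rule: dil_op.induct)
     (auto intro: periodic_odd_add periodic_odd_scale periodic_odd_zero periodic_odd_dil)

lemma dil_op_nrm: "dil_op A r \<Longrightarrow> f \<in> periodic_odd \<Longrightarrow> nrm (A f) \<le> r * nrm f"
proof (induction rule: dil_op.induct)
  case (dil A r k) then show ?case by (simp add: nrm_dil dil_op_periodic_odd)
next
  case (add_scale A r B s c)
  have "nrm (\<lambda>x. A f x + c * B f x) \<le> nrm (A f) + nrm (\<lambda>x. c * B f x)"
    using dil_op_periodic_odd[OF add_scale.hyps(1) add_scale.prems]
      dil_op_periodic_odd[OF add_scale.hyps(2) add_scale.prems]
    by (intro nrm_triangle periodic_odd_L2 periodic_odd_scale)
  also have "\<dots> \<le> r * nrm f + norm c * (s * nrm f)"
    unfolding nrm_scale using add_scale by (intro add_mono mult_left_mono) auto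
  finally show ?case by (simp add: algebra_simps)
qed (simp_all add: nrm_def)

lemma dil_op_diff: "dil_op A r \<Longrightarrow> A (\<lambda>x. f x - g x) = (\<lambda>x. A f x - A g x)"
proof (induction rule: dil_op.induct)
  case (add_scale A r B s c)
  show ?case unfolding add_scale.IH by (simp add: algebra_simps fun_eq_iff)
qed (auto simp: dil_def fun_eq_iff)

text \<open>\<open>closed\<close> speaks only of limits that are themselves in
  \<open>periodic_odd\<close>, so M stands for the bounded part of a closed subspace. Arguing about
  every such M keeps explicit approximation by dilates out of the algebra.\<close>

locale dilation_invariant =
  fixes M :: "(real \<Rightarrow> complex) set"
  assumes periodic_odd: "f \<in> M \<Longrightarrow> f \<in> periodic_odd"
    and zero: "(\<lambda>x. 0) \<in> M"
    and add: "f \<in> M \<Longrightarrow> g \<in> M \<Longrightarrow> (\<lambda>x. f x + g x) \<in> M"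
    and scale: "f \<in> M \<Longrightarrow> (\<lambda>x. c * f x) \<in> M"
    and dil: "f \<in> M \<Longrightarrow> k > 0 \<Longrightarrow> dil k f \<in> M"
    and closed: "f \<in> periodic_odd \<Longrightarrow> (\<And>e. e > 0 \<Longrightarrow> \<exists>g\<in>M. nrm (\<lambda>x. f x - g x) < e) \<Longrightarrow> f \<in> M"
begin

lemma diff: "f \<in> M \<Longrightarrow> g \<in> M \<Longrightarrow> (\<lambda>x. f x - g x) \<in> M"
  using add[OF _ scale[of g "-1"], of f] by simp

lemma sum: "(\<And>i. i \<in> I \<Longrightarrow> f i \<in> M) \<Longrightarrow> (\<lambda>x. \<Sum>i\<in>I. f i x) \<in> M"
  by (induction I rule: infinite_finite_induct) (auto intro: zero add)

text \<open>Transfers membership along identities that hold at irrational points only.\<close>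

lemma nrm_eq_0:
  assumes "f \<in> M" "g \<in> periodic_odd" "nrm (\<lambda>x. g x - f x) = 0"
  shows "g \<in> M"
  using assms by (intro closed) (auto intro!: bexI[of _ f])

lemma seq_closed:
  assumes "f \<in> periodic_odd" "\<And>n. g n \<in> M" "(\<lambda>n::nat. nrm (\<lambda>x. f x - g n x)) \<longlonglongrightarrow> 0"
  shows "f \<in> M"
proof (rule closed[OF assms(1)])
  fix e :: real assume "e > 0"
  then obtain n where "nrm (\<lambda>x. f x - g n x) < e"
    using LIMSEQ_D[OF assms(3), of e] by auto
  then show "\<exists>g\<in>M. nrm (\<lambda>x. f x - g x) < e" using assms(2) by blast
qed

lemma dil_op_mem: "dil_op A r \<Longrightarrow> f \<in> M \<Longrightarrow> A f \<in> M"
  by (induction rule: dil_op.induct) (auto intro: zero add scale dil)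

text \<open>f - A^n f telescopes into the terms A^j (f - A f), all in M, while |A^n f| <= r^n |f|
  tends to 0. So f is a limit of members of M.\<close>

lemma neumann:
  assumes A: "dil_op A r" and r: "r < 1" and f: "f \<in> periodic_odd"
    and mem: "(\<lambda>x. f x - A f x) \<in> M"
  shows "f \<in> M"
proof (rule seq_closed[OF f])
  define T where "T n = (A ^^ n) f" for n
  have T: "T n \<in> periodic_odd" for n
    unfolding T_def by (induction n) (auto simp: f dil_op_periodic_odd[OF A])
  have step: "(\<lambda>x. T n x - T (Suc n) x) \<in> M" for n
  proof (induction n)
    case 0 then show ?case using mem by (simp add: T_def)
  next
    case (Suc n)
    then show ?case using dil_op_mem[OF A Suc] dil_op_diff[OF A, of "T n" "T (Suc n)"]
      by (simp add: T_def)
  qed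
  show "(\<lambda>x. f x - T n x) \<in> M" for n
  proof (induction n)
    case 0 then show ?case using zero by (simp add: T_def)
  next
    case (Suc n) then show ?case using add[OF Suc step[of n]] by simp
  qed
  have "nrm (T n) \<le> r ^ n * nrm f" for n
  proof (induction n)
    case 0 then show ?case by (simp add: T_def)
  next
    case (Suc n)
    have "nrm (T (Suc n)) \<le> r * nrm (T n)"
      using dil_op_nrm[OF A T[of n]] by (simp add: T_def)
    then show ?case using mult_left_mono[OF Suc dil_op_nonneg[OF A]] by (simp add: mult_ac)
  qed
  moreover have "(\<lambda>n. r ^ n * nrm f) \<longlonglongrightarrow> 0 * nrm f"
    using r dil_op_nonneg[OF A] by (intro tendsto_intros LIMSEQ_realpow_zero) auto
  ultimately have "(\<lambda>n. nrm (T n)) \<longlonglongrightarrow> 0"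
    by (intro Lim_null_comparison[where f = "\<lambda>n. nrm (T n)"]) auto
  then show "(\<lambda>n. nrm (\<lambda>x. f x - (f x - T n x))) \<longlonglongrightarrow> 0" by simp
qed

text \<open>Modulo M the function h equals its Cesaro mean E_N h over the powers of cT_p. The means
  are contractions and tend to 0 on each sine, hence on h by density of sine polynomials.\<close>

lemma cesaro:
  assumes p: "p \<ge> 2" and c: "norm c \<le> 1" and h: "h \<in> periodic_odd"
    and mem: "(\<lambda>x. h x - c * dil p h x) \<in> M"
  shows "h \<in> M"
proof (rule closed[OF h])
  fix e :: real assume "e > 0"
  define E where "E N f x = (\<Sum>n\<in>{1..N}. (c ^ n / of_nat N) * dil (p ^ n) f x)" for N f x
  have EV: "E N f \<in> periodic_odd" if "f \<in> periodic_odd" for N f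
    unfolding E_def by (intro periodic_odd_sum periodic_odd_scale periodic_odd_dil that)
  have E_nrm: "nrm (E N f) \<le> nrm f" if f: "f \<in> periodic_odd" for N f
  proof -
    have "nrm (E N f) \<le> (\<Sum>n\<in>{1..N}. nrm (\<lambda>x. (c ^ n / of_nat N) * dil (p ^ n) f x))"
      unfolding E_def by (intro nrm_sum periodic_odd_scale periodic_odd_dil f)
    also have "\<dots> \<le> (\<Sum>n\<in>{1..N}. 1 / real N * nrm f)"
      unfolding nrm_scale using p c f
      by (intro sum_mono mult_mono) (auto simp: norm_divide norm_power nrm_dil divide_right_mono power_le_one)
    also have "\<dots> \<le> nrm f" by simp
    finally show ?thesis .
  qed
  have hE: "(\<lambda>x. h x - E N h x) \<in> M" if N: "N > 0" for N
  proof -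
    \<comment> \<open>Modulo M, h is fixed by cT_p and therefore by every power of it.\<close>
    have step: "(\<lambda>x. h x - c ^ n * dil (p ^ n) h x) \<in> M" for n
    proof (induction n)
      case 0 then show ?case using zero by simp
    next
      case (Suc n)
      have "(\<lambda>x. c ^ n * dil (p ^ n) (\<lambda>x. h x - c * dil p h x) x) \<in> M"
        using p by (intro scale dil mem) auto
      from add[OF Suc this] show ?case
        by (simp add: dil_def algebra_simps)
    qed
    have "(\<lambda>x. \<Sum>n\<in>{1..N}. (1 / of_nat N) * (h x - c ^ n * dil (p ^ n) h x)) \<in> M"
      by (intro sum scale step)
    moreover have "(\<Sum>n\<in>{1..N}. (1 / of_nat N) * (h x - c ^ n * dil (p ^ n) h x)) = h x - E N h x" for x
      using N by (simp add: E_def sum_subtractf right_diff_distrib)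
    ultimately show ?thesis by simp
  qed
  \<comment> \<open>The frequencies p^n k are distinct, so this is a sum of N orthogonal terms of
    size at most 1/N, and the norm decays like the inverse square root of N.\<close>
  have E_sn: "nrm (E N (sn k)) \<le> sqrt (1 / real N)" if N: "N > 0" and k: "k > 0" for N k
  proof -
    let ?f = "\<lambda>n. p ^ n * k"
    have inj: "inj_on ?f {1..N}" using p k by (auto simp: inj_on_def)
    \<comment> \<open>Relabels the coefficient of the n-th summand by its frequency p^n k, which is
      the form required by \<open>nrm_sine_sum\<close>.\<close>
    define b where "b m = c ^ (the_inv_into {1..N} ?f m) / of_nat N" for m
    have b: "b (?f n) = c ^ n / of_nat N" if "n \<in> {1..N}" for n
      using the_inv_into_f_f[OF inj that] by (simp add: b_def)
    have "E N (sn k) = sine_sum (?f ` {1..N}) b"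
      unfolding E_def sine_sum_def sum.reindex[OF inj] o_def
      by (auto simp: fun_eq_iff b dil_sn intro!: sum.cong)
    then have "(nrm (E N (sn k)))^2 = (\<Sum>m\<in>?f ` {1..N}. (norm (b m))^2) / 2"
      using p k by (simp add: nrm_sine_sum image_iff)
    also have "\<dots> = (\<Sum>n\<in>{1..N}. (norm (c ^ n / of_nat N))^2) / 2"
      unfolding sum.reindex[OF inj] o_def
      by (intro arg_cong[where f = "\<lambda>t. t / 2"] sum.cong refl) (simp only: b)
    also have "\<dots> \<le> (\<Sum>n\<in>{1..N}. (1 / real N)^2) / 2"
      using c by (intro divide_right_mono sum_mono power_mono)
        (auto simp: norm_divide norm_power divide_right_mono power_le_one)
    also have "\<dots> \<le> 1 / real N" using N by (simp add: power2_eq_square field_simps)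
    finally show ?thesis by (rule real_le_rsqrt)
  qed
  have "sine_limit h" using h by (intro sine_limit_L2_01 periodic_odd_L2)
  then obtain K b where s: "nrm (\<lambda>x. h x - sine_sum {1..K} b x) < e / 2"
    using half_gt_zero[OF \<open>e > 0\<close>] unfolding sine_limit_def sine_poly_def by blast
  let ?s = "sine_sum {1..K} b"
  define Z where "Z = (\<Sum>k\<in>{1..K}. norm (b k))"
  have Es: "nrm (E N ?s) \<le> Z * sqrt (1 / real N)" if N: "N > 0" for N
  proof -
    have "E N ?s = (\<lambda>x. \<Sum>k\<in>{1..K}. b k * E N (sn k) x)"
      unfolding E_def sine_sum_def dil_def sum_distrib_left
      by (subst sum.swap) (simp add: mult_ac)
    moreover have "nrm (\<lambda>x. \<Sum>k\<in>{1..K}. b k * E N (sn k) x) \<le> (\<Sum>k\<in>{1..K}. nrm (\<lambda>x. b k * E N (sn k) x))"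
      by (intro nrm_sum periodic_odd_scale EV periodic_odd_sn)
    ultimately have "nrm (E N ?s) \<le> (\<Sum>k\<in>{1..K}. nrm (\<lambda>x. b k * E N (sn k) x))"
      by (simp only:)
    also have "\<dots> \<le> (\<Sum>k\<in>{1..K}. norm (b k) * sqrt (1 / real N))"
      unfolding nrm_scale using E_sn[OF N] by (intro sum_mono mult_left_mono) auto
    finally show ?thesis by (simp add: Z_def sum_distrib_right)
  qed
  have "(\<lambda>N. Z * sqrt (1 / real N)) \<longlonglongrightarrow> Z * sqrt 0"
    by (intro tendsto_intros lim_1_over_n)
  then have "eventually (\<lambda>N. Z * sqrt (1 / real N) < e / 2) sequentially"
    using \<open>e > 0\<close> by (intro order_tendstoD) auto
  then obtain N0 where N0: "\<And>N. N \<ge> N0 \<Longrightarrow> Z * sqrt (1 / real N) < e / 2"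
    unfolding eventually_sequentially by blast
  obtain N where N: "N > 0" "Z * sqrt (1 / real N) < e / 2"
    using N0[of "Suc N0"] that[of "Suc N0"] by simp
  have "E N h = (\<lambda>x. E N (\<lambda>x. h x - ?s x) x + E N ?s x)"
    by (auto simp: E_def dil_def fun_eq_iff algebra_simps simp flip: sum.distrib)
  then have "nrm (E N h) \<le> nrm (E N (\<lambda>x. h x - ?s x)) + nrm (E N ?s)"
    using nrm_triangle[of "E N (\<lambda>x. h x - ?s x)" "E N ?s"] h
    by (simp add: periodic_odd_L2 EV periodic_odd_diff periodic_odd_sine_sum)
  also have "\<dots> < e"
    using E_nrm[of "\<lambda>x. h x - ?s x" N] s Es[OF N(1)] N(2) h
    by (simp add: periodic_odd_diff periodic_odd_sine_sum)
  finally have "nrm (\<lambda>x. h x - (h x - E N h x)) < e" by simp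
  then show "\<exists>g\<in>M. nrm (\<lambda>x. h x - g x) < e" 
    using hE[OF N(1)] by (intro bexI[of _ "\<lambda>x. h x - E N h x"])
qed

end

section \<open>Recovering sin(pi x) by sieving out primes\<close>

lemma sum_inverse_squares_tail_le:
  assumes "P > 0"
  shows "(\<Sum>k\<in>{1..N}. if k > P then 1 / (real k)^2 else 0) \<le> (if N > P then 1 / real P - 1 / real N else 0)"
proof (induction N)
  case (Suc N)
  \<comment> \<open>The telescoping bound; the term -1/N in the claim is what lets the induction
    close.\<close>
  have *: "1 / (real (Suc N))^2 \<le> 1 / real N - 1 / real (Suc N)" if "N > 0"
  proof -
    have "1 / (real (Suc N))^2 \<le> 1 / (real N * real (Suc N))"
      using that by (intro divide_left_mono) (auto simp: power2_eq_square)
    also have "\<dots> = 1 / real N - 1 / real (Suc N)" using that by (simp add: field_simps)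
    finally show ?thesis .
  qed
  consider "Suc N < P \<or> Suc N = P" | "N = P" | "N > P" by linarith
  then show ?case
  proof cases
    case 3
    then show ?thesis using Suc * assms by simp
  qed (use Suc * assms in auto)
qed simp

lemma has_coeffs_sn_1: "has_coeffs (sn 1) (\<lambda>k. if k = 1 then 1 else 0)"
proof -
  have "sine_sum {1..N} (\<lambda>k. if k = 1 then 1 else 0) = sn 1" if "N \<ge> 1" for N
    using that by (auto simp: sine_sum_def fun_eq_iff if_distrib[of "\<lambda>x. x * _"] sum.delta cong: if_cong)
  then have "eventually (\<lambda>N. nrm (\<lambda>x. sn 1 x - sine_sum {1..N} (\<lambda>k. if k = 1 then 1 else 0) x) = 0) sequentially"
    unfolding eventually_sequentially by (intro exI[of _ 1]) (auto simp: nrm_def)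
  then show ?thesis unfolding has_coeffs_def
    by (auto intro: periodic_odd_sn tendsto_eventually)
qed

context dilation_invariant
begin

text \<open>Applying 1 - a(p)T_p subtracts a(p) a(k/p) = a(k) at the multiples of p and so deletes
  them. Earlier deletions persist, because a prime different from p divides k iff it divides
  k/p.\<close>

lemma sieve:
  assumes F: "has_coeffs F (\<lambda>k. C * a k)" "F \<in> M"
    and mult: "\<And>m n. a (m * n) = a m * a n"
    and A: "finite A" "\<And>p. p \<in> A \<Longrightarrow> prime (p::nat)"
  shows "\<exists>g\<in>M. has_coeffs g (\<lambda>k. if \<exists>p\<in>A. p dvd k then 0 else C * a k)"
  using A
proof (induction A rule: finite_induct)
  case empty then show ?case using F by auto
next
  case (insert p A)
  then obtain g where g: "g \<in> M" "has_coeffs g (\<lambda>k. if \<exists>p\<in>A. p dvd k then 0 else C * a k)" by auto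
  have p: "prime p" using insert by simp
  then have p0: "p > 0" by (simp add: prime_gt_0_nat)
  have "(\<lambda>x. g x - a p * dil p g x) \<in> M" using g(1) p0 by (intro diff scale dil)
  moreover have "(\<lambda>k. (if \<exists>p\<in>A. p dvd k then 0 else C * a k) -
      a p * (if p dvd k then (if \<exists>q\<in>A. q dvd k div p then 0 else C * a (k div p)) else 0)) =
      (\<lambda>k. if \<exists>p\<in>insert p A. p dvd k then 0 else C * a k)" (is "?l = ?r")
  proof
    fix k
    show "?l k = ?r k"
    proof (cases "p dvd k")
      case True
      then obtain j where k: "k = p * j" by blast
      have "q dvd k \<longleftrightarrow> q dvd j" if "q \<in> A" for q
        using that insert p k by (metis insertCI prime_dvd_mult_iff primes_dvd_imp_eq)
      then show ?thesis using p0 k by (simp add: mult)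
    qed auto
  qed
  then have "has_coeffs (\<lambda>x. g x - a p * dil p g x)
      (\<lambda>k. if \<exists>p\<in>insert p A. p dvd k then 0 else C * a k)"
    using has_coeffs_sub_scale[OF g(2) has_coeffs_dil[OF g(2) p0], of "a p"] by simp
  ultimately show ?case by blast
qed

text \<open>Every k with 1 < k <= P has a prime factor at most P, so sieving by these primes leaves
  only k = 1 and indices beyond P. The latter contribute at most the tail of the sum of 1/k^2, which
  is below 1/P.\<close>

lemma sn_1_mem:
  assumes F: "has_coeffs F (\<lambda>k. C * a k)" "F \<in> M" and C: "C \<noteq> 0"
    and mult: "\<And>m n. a (m * n) = a m * a n" and a1: "a 1 = 1"
    and le: "\<And>k. k > 0 \<Longrightarrow> norm (a k) \<le> 1 / real k"
  shows "sn 1 \<in> M"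
proof (rule closed[OF periodic_odd_sn])
  fix e :: real assume "e > 0"
  obtain P where P: "P > 0" "1 / real P < e^2"
    using ex_inverse_of_nat_less[of "e^2"] \<open>e > 0\<close> by (auto simp: inverse_eq_divide)
  let ?A = "{p. prime p \<and> p \<le> P}"
  have "finite ?A" by (rule finite_subset[of _ "{..P}"]) auto
  then obtain g where g0: "g \<in> M" "has_coeffs g (\<lambda>k. if \<exists>p\<in>?A. p dvd k then 0 else C * a k)"
    using sieve[where F = F and C = C and a = a and A = "?A"] F mult by blast
  define R where "R k \<longleftrightarrow> (\<exists>p\<in>?A. p dvd k)" for k
  have g: "g \<in> M" "has_coeffs g (\<lambda>k. if R k then 0 else C * a k)"
    using g0 by (simp_all only: R_def)
  \<comment> \<open>Coefficients of sin(pi x) - g/C; dividing by C makes the surviving coefficient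
    at 1 equal to a(1) = 1, so it cancels.\<close>
  define b where "b = (\<lambda>k. (if k = 1 then 1 else 0) - 1 / C * (if R k then 0 else C * a k))"
  have b: "has_coeffs (\<lambda>x. sn 1 x - 1 / C * g x) b"
    unfolding b_def using has_coeffs_sub_scale[OF has_coeffs_sn_1 g(2), of "1 / C"] .
  have b_le: "(norm (b k))^2 \<le> (if k > P then 1 / (real k)^2 else 0)" if k: "k \<in> {1..N}" for k N
  proof (cases "k > P")
    case True
    have "b k = (if R k then 0 else - a k)"
      unfolding b_def using True P(1) C by simp
    moreover have "norm (a k) \<le> 1 / real k" using le[of k] k by simp
    ultimately have "norm (b k) \<le> 1 / real k" by simp
    then have "(norm (b k))^2 \<le> (1 / real k)^2" by (intro power_mono) auto
    then show ?thesis using True by (simp add: power_divide)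
  next
    case False
    have "b k = 0"
    proof (cases "k = 1")
      case True
      moreover have "\<not> R 1" unfolding R_def by auto
      ultimately show ?thesis using a1 C by (simp add: b_def)
    next
      case k1: False
      then obtain p where "prime p" "p dvd k" using prime_factor_nat by blast
      moreover have "p \<le> P" using \<open>p dvd k\<close> dvd_imp_le[of p k] k False by auto
      ultimately have "R k" unfolding R_def by blast
      then show ?thesis using k1 by (simp add: b_def)
    qed
    then show ?thesis using False by simp
  qed
  have "nrm (\<lambda>x. sn 1 x - 1 / C * g x) \<le> sqrt (1 / real P)"
  proof (rule has_coeffs_nrm_le[OF b])
    fix N
    have "(\<Sum>k\<in>{1..N}. (norm (b k))^2) \<le> (\<Sum>k\<in>{1..N}. if k > P then 1 / (real k)^2 else 0)"
      using b_le by (intro sum_mono)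
    also have "\<dots> \<le> (if N > P then 1 / real P - 1 / real N else 0)"
      by (rule sum_inverse_squares_tail_le[OF P(1)])
    also have "\<dots> \<le> 1 / real P" by simp
    finally show "(\<Sum>k\<in>{1..N}. (norm (b k))^2) \<le> 2 * (sqrt (1 / real P))^2"
      by (simp add: order_trans[OF _ divide_right_mono])
  qed simp
  also have "\<dots> < e" using P(2) \<open>e > 0\<close> by (intro real_less_lsqrt) auto
  finally show "\<exists>g\<in>M. nrm (\<lambda>x. sn 1 x - g x) < e"
    using scale[OF g(1), of "1 / C"] by (intro bexI[of _ "\<lambda>x. 1 / C * g x"])
qed

lemma sine_poly_mem:
  assumes "sn 1 \<in> M" "sine_poly p"
  shows "p \<in> M"
proof -
  have sn: "sn k \<in> M" if "k > 0" for k
    using dil[OF assms(1) that] by (simp add: dil_sn)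
  obtain N a where p: "p = sine_sum {1..N} a" using assms(2) by (auto simp: sine_poly_def)
  have "(\<lambda>x. \<Sum>k\<in>{1..N}. a k * sn k x) \<in> M"
    by (intro sum scale sn) auto
  then show ?thesis by (simp add: p sine_sum_def[abs_def])
qed

end

section \<open>The closed span of the dilates of one function\<close>

definition dil_comb :: "(real \<Rightarrow> complex) \<Rightarrow> (real \<Rightarrow> complex) \<Rightarrow> bool" where
  "dil_comb \<phi> g \<longleftrightarrow> (\<exists>K a. finite K \<and> 0 \<notin> K \<and> g = (\<lambda>x. \<Sum>k\<in>K. a k * dil k \<phi> x))"

lemma dil_comb_periodic_odd: "\<phi> \<in> periodic_odd \<Longrightarrow> dil_comb \<phi> g \<Longrightarrow> g \<in> periodic_odd"
  by (auto simp: dil_comb_def intro!: periodic_odd_sum periodic_odd_scale periodic_odd_dil)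

lemma dil_comb_zero: "dil_comb \<phi> (\<lambda>x. 0)"
  unfolding dil_comb_def by (intro exI[of _ "{}"]) auto

lemma dil_comb_self: "dil_comb \<phi> \<phi>"
  unfolding dil_comb_def by (intro exI[of _ "{1}"] exI[of _ "\<lambda>_. 1"]) auto

text \<open>Both coefficient families are padded with 0 to the union of the index sets. Arbitrary
  finite sets of positive indices, unlike initial segments, are also stable under multiplication by
  n in \<open>dil_comb_dil\<close>.\<close>

lemma dil_comb_add:
  assumes "dil_comb \<phi> f" "dil_comb \<phi> g"
  shows "dil_comb \<phi> (\<lambda>x. f x + g x)"
proof -
  obtain K a L b where f: "finite K" "0 \<notin> K" "f = (\<lambda>x. \<Sum>k\<in>K. a k * dil k \<phi> x)"
    and g: "finite L" "0 \<notin> L" "g = (\<lambda>x. \<Sum>k\<in>L. b k * dil k \<phi> x)"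
    using assms by (auto simp: dil_comb_def)
  define a' b' where "a' k = (if k \<in> K then a k else 0)" and "b' k = (if k \<in> L then b k else 0)" for k
  have "f x = (\<Sum>k\<in>K \<union> L. a' k * dil k \<phi> x)" for x
    unfolding f(3) using f g by (intro sum.mono_neutral_cong_left) (auto simp: a'_def)
  moreover have "g x = (\<Sum>k\<in>K \<union> L. b' k * dil k \<phi> x)" for x
    unfolding g(3) using f g by (intro sum.mono_neutral_cong_left) (auto simp: b'_def)
  ultimately have "(\<lambda>x. f x + g x) = (\<lambda>x. \<Sum>k\<in>K \<union> L. (a' k + b' k) * dil k \<phi> x)"
    by (simp add: sum.distrib distrib_right)
  then show ?thesis unfolding dil_comb_def
    using f g by (intro exI[of _ "K \<union> L"] exI[of _ "\<lambda>k. a' k + b' k"]) auto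
qed

lemma dil_comb_scale:
  assumes "dil_comb \<phi> f"
  shows "dil_comb \<phi> (\<lambda>x. c * f x)"
proof -
  obtain K a where f: "finite K" "0 \<notin> K" "f = (\<lambda>x. \<Sum>k\<in>K. a k * dil k \<phi> x)"
    using assms by (auto simp: dil_comb_def)
  then show ?thesis unfolding dil_comb_def
    by (intro exI[of _ K] exI[of _ "\<lambda>k. c * a k"]) (auto simp: sum_distrib_left mult.assoc)
qed

lemma dil_comb_dil:
  assumes "dil_comb \<phi> f" "n > 0"
  shows "dil_comb \<phi> (dil n f)"
proof -
  obtain K a where f: "finite K" "0 \<notin> K" "f = (\<lambda>x. \<Sum>k\<in>K. a k * dil k \<phi> x)"
    using assms by (auto simp: dil_comb_def)
  have inj: "inj_on ((*) n) K" using assms(2) by (auto simp: inj_on_def)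
  have "dil n f = (\<lambda>x. \<Sum>k\<in>(*) n ` K. a (k div n) * dil k \<phi> x)"
    unfolding sum.reindex[OF inj] o_def using assms(2) by (auto simp: f dil_def fun_eq_iff mult_ac)
  then show ?thesis unfolding dil_comb_def
    using f assms(2) by (intro exI[of _ "(*) n ` K"] exI[of _ "\<lambda>k. a (k div n)"]) auto
qed

definition dil_closure :: "(real \<Rightarrow> complex) \<Rightarrow> (real \<Rightarrow> complex) set" where
  "dil_closure \<phi> = {f \<in> periodic_odd. \<forall>e>0. \<exists>g. dil_comb \<phi> g \<and> nrm (\<lambda>x. f x - g x) < e}"

lemma dil_closure_invariant:
  assumes \<phi>: "\<phi> \<in> periodic_odd"
  shows "dilation_invariant (dil_closure \<phi>)"
proof
  note V = dil_comb_periodic_odd[OF \<phi>]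
  show "f \<in> periodic_odd" if "f \<in> dil_closure \<phi>" for f using that by (simp add: dil_closure_def)
  show "(\<lambda>x. 0) \<in> dil_closure \<phi>"
    using dil_comb_zero[of \<phi>] by (auto simp: dil_closure_def periodic_odd_zero nrm_def intro!: exI[of _ "\<lambda>x. 0"])
  show "(\<lambda>x. f x + g x) \<in> dil_closure \<phi>" if fg: "f \<in> dil_closure \<phi>" "g \<in> dil_closure \<phi>" for f g
  proof -
    have fgV: "f \<in> periodic_odd" "g \<in> periodic_odd" using fg by (auto simp: dil_closure_def)
    have "\<exists>h. dil_comb \<phi> h \<and> nrm (\<lambda>x. f x + g x - h x) < e" if e: "e > 0" for e
    proof -
      obtain f' where f': "dil_comb \<phi> f'" "nrm (\<lambda>x. f x - f' x) < e/2"
        using fg(1) half_gt_zero[OF e] unfolding dil_closure_def by blast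
      obtain g' where g': "dil_comb \<phi> g'" "nrm (\<lambda>x. g x - g' x) < e/2"
        using fg(2) half_gt_zero[OF e] unfolding dil_closure_def by blast
      have "nrm (\<lambda>x. (f x - f' x) + (g x - g' x)) \<le> nrm (\<lambda>x. f x - f' x) + nrm (\<lambda>x. g x - g' x)"
        using V f' g' fgV by (intro nrm_triangle periodic_odd_L2 periodic_odd_diff)
      moreover have "(\<lambda>x. (f x - f' x) + (g x - g' x)) = (\<lambda>x. f x + g x - (f' x + g' x))" by auto
      ultimately have "nrm (\<lambda>x. f x + g x - (f' x + g' x)) < e" using f' g' by simp
      then show ?thesis using dil_comb_add[OF f'(1) g'(1)] by (intro exI[of _ "\<lambda>x. f' x + g' x"] conjI)
    qed
    then show ?thesis using fgV by (simp add: dil_closure_def periodic_odd_add)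
  qed
  show "(\<lambda>x. c * f x) \<in> dil_closure \<phi>" if f: "f \<in> dil_closure \<phi>" for f c
  proof -
    have fV: "f \<in> periodic_odd" using f by (auto simp: dil_closure_def)
    have "\<exists>h. dil_comb \<phi> h \<and> nrm (\<lambda>x. c * f x - h x) < e" if e: "e > 0" for e
    proof -
      \<comment> \<open>The summand 1 covers c = 0.\<close>
      have pos: "e / (norm c + 1) > 0" using e by (intro divide_pos_pos add_nonneg_pos) auto
      obtain f' where f': "dil_comb \<phi> f'" "nrm (\<lambda>x. f x - f' x) < e / (norm c + 1)"
        using f pos unfolding dil_closure_def by blast
      have "nrm (\<lambda>x. c * f x - c * f' x) = norm c * nrm (\<lambda>x. f x - f' x)"
        using nrm_scale[of c "\<lambda>x. f x - f' x"] by (simp add: right_diff_distrib)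
      also have "\<dots> \<le> norm c * (e / (norm c + 1))" using f'(2) by (intro mult_left_mono) auto
      also have "\<dots> < (norm c + 1) * (e / (norm c + 1))"
        using pos by (intro mult_strict_right_mono) auto
      also have "\<dots> = e"
        using add_nonneg_pos[OF norm_ge_zero[of c] zero_less_one] by simp
      finally show ?thesis using dil_comb_scale[OF f'(1)] by (intro exI[of _ "\<lambda>x. c * f' x"] conjI)
    qed
    then show ?thesis using fV by (simp add: dil_closure_def periodic_odd_scale)
  qed
  show "dil k f \<in> dil_closure \<phi>" if f: "f \<in> dil_closure \<phi>" and k: "k > 0" for f k
  proof -
    have fV: "f \<in> periodic_odd" using f by (auto simp: dil_closure_def)
    have "\<exists>h. dil_comb \<phi> h \<and> nrm (\<lambda>x. dil k f x - h x) < e" if e: "e > 0" for e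
    proof -
      obtain f' where f': "dil_comb \<phi> f'" "nrm (\<lambda>x. f x - f' x) < e"
        using f e unfolding dil_closure_def by blast
      have "nrm (\<lambda>x. dil k f x - dil k f' x) = nrm (\<lambda>x. f x - f' x)"
        using nrm_dil[OF periodic_odd_diff[OF fV V[OF f'(1)]] k] by (simp add: dil_def[abs_def])
      then show ?thesis using f' dil_comb_dil[OF f'(1) k] by (intro exI[of _ "dil k f'"]) auto
    qed
    then show ?thesis using fV by (simp add: dil_closure_def periodic_odd_dil)
  qed
  show "f \<in> dil_closure \<phi>" if f: "f \<in> periodic_odd"
    and appr: "\<And>e. e > 0 \<Longrightarrow> \<exists>g\<in>dil_closure \<phi>. nrm (\<lambda>x. f x - g x) < e" for f
  proof -
    have "\<exists>h. dil_comb \<phi> h \<and> nrm (\<lambda>x. f x - h x) < e" if e: "e > 0" for e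
    proof -
      obtain g where g: "g \<in> dil_closure \<phi>" "nrm (\<lambda>x. f x - g x) < e/2"
        using appr[OF half_gt_zero[OF e]] by blast
      obtain h where h: "dil_comb \<phi> h" "nrm (\<lambda>x. g x - h x) < e/2"
        using g(1) half_gt_zero[OF e] unfolding dil_closure_def by blast
      have "g \<in> periodic_odd" using g by (simp add: dil_closure_def)
      then have "nrm (\<lambda>x. f x - h x) \<le> nrm (\<lambda>x. f x - g x) + nrm (\<lambda>x. g x - h x)"
        by (intro nrm_triangle3 periodic_odd_L2 f V[OF h(1)])
      then show ?thesis using g h by (intro exI[of _ h]) auto
    qed
    then show ?thesis using f by (simp add: dil_closure_def)
  qed
qed

text \<open>Applied to the closed span of the dilates, the criterion puts sin(pi x), hence its
  dilates and all sine polynomials, into that span, and these are dense.\<close>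

theorem cyclic_C_criterion:
  assumes \<phi>: "\<phi> \<in> L2_01" "odd_ext \<phi> \<in> periodic_odd"
    and crit: "\<And>M. dilation_invariant M \<Longrightarrow> odd_ext \<phi> \<in> M \<Longrightarrow> sn 1 \<in> M"
  shows "cyclic_C \<phi>"
  unfolding cyclic_C_def
proof (intro conjI ballI allI impI \<phi>(1))
  fix g :: "real \<Rightarrow> complex" and \<epsilon> :: real
  assume g: "g \<in> L2_01" and "\<epsilon> > 0"
  \<comment> \<open>\<open>cyclic_C\<close> measures the squared norm.\<close>
  define e where "e = sqrt \<epsilon>"
  have e: "e > 0" using \<open>\<epsilon> > 0\<close> by (simp add: e_def)
  interpret dilation_invariant "dil_closure (odd_ext \<phi>)" by (rule dil_closure_invariant[OF \<phi>(2)])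
  have "odd_ext \<phi> \<in> dil_closure (odd_ext \<phi>)"
    using \<phi>(2) dil_comb_self by (auto simp: dil_closure_def nrm_def intro!: exI[of _ "odd_ext \<phi>"])
  then have sn1: "sn 1 \<in> dil_closure (odd_ext \<phi>)" by (rule crit[OF dilation_invariant_axioms])
  obtain p where p: "sine_poly p" "nrm (\<lambda>x. g x - p x) < e/2"
    using sine_limit_L2_01[OF g] half_gt_zero[OF e] unfolding sine_limit_def by blast
  then have "p \<in> dil_closure (odd_ext \<phi>)" using sine_poly_mem[OF sn1] by blast
  then obtain h where h: "dil_comb (odd_ext \<phi>) h" "nrm (\<lambda>x. p x - h x) < e/2"
    using half_gt_zero[OF e] unfolding dil_closure_def by blast
  obtain K a where K: "finite K" "0 \<notin> K" "h = (\<lambda>x. \<Sum>k\<in>K. a k * dil k (odd_ext \<phi>) x)"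
    using h(1) by (auto simp: dil_comb_def)
  define b where "b k = (if k \<in> K then a k else 0)" for k
  \<comment> \<open>Inserting 1 gives \<open>Max\<close> a nonempty set even if K is empty; the gaps
    below N are filled with coefficient 0.\<close>
  define N where "N = Max (insert 1 K)"
  have sub: "K \<subseteq> {1..N}"
  proof
    fix k assume "k \<in> K"
    moreover have "k \<le> N" unfolding N_def using K(1) \<open>k \<in> K\<close> by (intro Max_ge) auto
    ultimately show "k \<in> {1..N}" using K(2) by (cases k) auto
  qed
  have h_eq: "h x = (\<Sum>k\<in>{1..N}. b k * odd_ext \<phi> (real k * x))" for x
    unfolding K(3) dil_def using sub by (intro sum.mono_neutral_cong_left) (auto simp: b_def)
  have "nrm (\<lambda>x. g x - h x) \<le> nrm (\<lambda>x. g x - p x) + nrm (\<lambda>x. p x - h x)"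
    by (intro nrm_triangle3 g periodic_odd_L2 sine_poly_periodic_odd[OF p(1)]
        dil_comb_periodic_odd[OF \<phi>(2) h(1)])
  then have "nrm (\<lambda>x. g x - h x) < e" using p h by simp
  then have "(nrm (\<lambda>x. g x - h x))^2 < e^2" by (intro power_strict_mono) auto
  then have "(LINT x|I01. (norm (g x - (\<Sum>k\<in>{1..N}. b k * odd_ext \<phi> (real k * x))))^2) < \<epsilon>"
    using \<open>\<epsilon> > 0\<close> by (simp add: nrm_square e_def h_eq)
  then show "\<exists>N a. (LINT x|I01. (norm (g x - (\<Sum>k\<in>{1..N}. a k * odd_ext \<phi> (real k * x))))^2) < \<epsilon>"
    by blast
qed

section \<open>Gauss sums of primitive characters\<close>

locale prim_char =
  fixes q :: nat and \<psi> :: "nat \<Rightarrow> complex"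
  assumes prim: "primitive_char q \<psi>" and q1: "q > 1"
begin

lemma char_mult: "\<psi> (m * n) = \<psi> m * \<psi> n"
  and char_period: "\<psi> (n + q) = \<psi> n"
  and char_nonzero: "\<psi> n \<noteq> 0 \<longleftrightarrow> coprime n q"
  using prim by (auto simp: primitive_char_def dirichlet_char_def)

lemma char_mod: "\<psi> (n mod q) = \<psi> n"
proof -
  have "\<psi> (r + k * q) = \<psi> r" for r k
  proof (induction k)
    case (Suc k)
    then show ?case using char_period[of "r + k * q"] by (simp add: algebra_simps)
  qed simp
  from this[of "n mod q" "n div q"] show ?thesis by simp
qed

lemma char_cong: "[m = n] (mod q) \<Longrightarrow> \<psi> m = \<psi> n"
  by (metis char_mod cong_def)

lemma char_0: "\<psi> 0 = 0"
  using char_nonzero[of 0] q1 by auto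

lemma char_1: "\<psi> (Suc 0) = 1"
  using char_nonzero[of "Suc 0"] char_mult[of "Suc 0" "Suc 0"] by simp

lemma char_power: "\<psi> (n ^ k) = \<psi> n ^ k"
  by (induction k) (auto simp: char_1 char_mult)

lemma ex_inverse:
  assumes "coprime n q"
  obtains m where "[n * m = 1] (mod q)" "coprime m q" "\<psi> n * \<psi> m = 1"
proof -
  obtain m where m: "[n * m = 1] (mod q)" using cong_solve_coprime_nat[OF assms] by auto
  have "\<psi> n * \<psi> m = 1" using char_cong[OF m] by (simp add: char_mult char_1)
  moreover from this have "\<psi> m \<noteq> 0" by auto
  ultimately show ?thesis using m that char_nonzero by blast
qed

text \<open>Periodicity bounds all values, whereas a value of modulus above 1 would have unbounded
  powers, which are again values of \<psi>.\<close>

lemma norm_char_le_1: "norm (\<psi> n) \<le> 1"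
proof (rule ccontr)
  assume "\<not> norm (\<psi> n) \<le> 1"
  define B where "B = (\<Sum>r<q. norm (\<psi> r))"
  have le: "norm (\<psi> m) \<le> B" for m
  proof -
    have "norm (\<psi> (m mod q)) \<le> B" unfolding B_def using q1 by (intro member_le_sum) auto
    then show ?thesis by (simp add: char_mod)
  qed
  obtain k where "B < norm (\<psi> n) ^ k"
    using real_arch_pow[of "norm (\<psi> n)" B] \<open>\<not> norm (\<psi> n) \<le> 1\<close> by auto
  then show False using le[of "n ^ k"] by (simp add: char_power norm_power)
qed

lemma norm_char: "norm (\<psi> n) = (if coprime n q then 1 else 0)"
proof (cases "coprime n q")
  case True
  obtain m where "\<psi> n * \<psi> m = 1" using ex_inverse[OF True] by metis
  then have "norm (\<psi> n) * norm (\<psi> m) = 1" by (metis norm_mult norm_one)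
  moreover have "norm (\<psi> n) * norm (\<psi> m) \<le> norm (\<psi> n) * 1"
    by (intro mult_left_mono norm_char_le_1) auto
  ultimately show ?thesis using True norm_char_le_1[of n] by simp
qed (use char_nonzero[of n] in auto)

text \<open>If \<psi> were 1 on all units congruent to 1 mod d, it would factor through the units
  mod d and so be induced from the proper divisor d, against primitivity.\<close>

lemma not_induced:
  assumes d: "d dvd q" "d < q"
  shows "\<exists>a. coprime a q \<and> [a = 1] (mod d) \<and> \<psi> a \<noteq> 1"
proof (rule ccontr)
  assume "\<not> ?thesis"
  then have triv: "\<psi> a = 1" if "coprime a q" "[a = 1] (mod d)" for a using that by blast
  have d0: "d > 0" using d q1 by (auto intro: Nat.gr0I)
  \<comment> \<open>Multiplying m by an inverse of n mod q gives a unit congruent to 1 mod d, where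
    \<psi> is trivial by assumption.\<close>
  have eq: "\<psi> m = \<psi> n" if mn: "coprime m q" "coprime n q" "[m = n] (mod d)" for m n
  proof -
    obtain i where i: "[n * i = 1] (mod q)" "coprime i q" "\<psi> n * \<psi> i = 1"
      using ex_inverse[OF mn(2)] by blast
    have "[m * i = n * i] (mod d)" using mn(3) by (rule cong_mult) auto
    also have "[n * i = 1] (mod d)" using i(1) d(1) by (rule cong_dvd_modulus_nat)
    finally have "\<psi> (m * i) = 1" using mn(1) i(2) by (intro triv) auto
    then have "\<psi> m * \<psi> i = \<psi> n * \<psi> i" using i(3) by (simp add: char_mult)
    then show ?thesis using i(3) by (metis mult_right_cancel mult_zero_right zero_neq_one)
  qed
  have ex: "\<exists>m. coprime m q \<and> [m = n] (mod d)" if n: "coprime n d" for n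
  proof -
    \<comment> \<open>With this j no prime p of q divides n + jd: if p divides n, then it divides
      neither j nor d; otherwise it divides j but not n.\<close>
    define j where "j = \<Prod>{p \<in> prime_factors q. \<not> p dvd n}"
    have "coprime (n + j * d) q"
    proof (rule ccontr)
      assume "\<not> coprime (n + j * d) q"
      then have "gcd (n + j * d) q \<noteq> 1" by (simp only: coprime_iff_gcd_eq_1 not_False_eq_True)
      then obtain p where "prime p" "p dvd gcd (n + j * d) q" using prime_factor_nat by blast
      then have p: "prime p" "p dvd n + j * d" "p dvd q" by simp_all
      have pq: "p \<in> prime_factors q" using p q1 by (auto simp: in_prime_factors_iff)
      show False
      proof (cases "p dvd n")
        case True
        then have "p dvd j * d" using p(2) by (simp add: dvd_add_right_iff)
        moreover have "\<not> p dvd d" using n True p(1) by (metis coprime_common_divisor not_prime_unit)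
        ultimately have "p dvd j" using p(1) by (simp add: prime_dvd_mult_iff)
        then obtain r where "r \<in> prime_factors q" "\<not> r dvd n" "p dvd r"
          unfolding j_def using p(1) by (auto simp: prime_dvd_prod_iff)
        then show False using True p(1) primes_dvd_imp_eq[of p r] by (auto simp: in_prime_factors_iff)
      next
        case False
        then have "p dvd j" unfolding j_def using pq by (intro dvd_prodI[where f = "\<lambda>x. x"]) auto
        then show False using False p(2) by (simp add: dvd_add_left_iff)
      qed
    qed
    moreover have "[n + j * d = n] (mod d)" by (simp add: cong_def)
    ultimately show ?thesis by blast
  qed
  define lift where "lift n = (SOME m. coprime m q \<and> [m = n] (mod d))" for n
  have lift: "coprime (lift n) q" "[lift n = n] (mod d)" if "coprime n d" for n
    using someI_ex[OF ex[OF that]] by (auto simp: lift_def)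
  \<comment> \<open>The candidate character mod d. By \<open>eq\<close> its value does not depend on
    which lift is chosen.\<close>
  define \<psi>' where "\<psi>' n = (if coprime n d then \<psi> (lift n) else 0)" for n
  have \<psi>'_eq: "\<psi>' n = \<psi> m" if "coprime n d" "coprime m q" "[m = n] (mod d)" for m n
  proof -
    have "[lift n = m] (mod d)" using lift(2)[OF that(1)] that(3) cong_sym cong_trans by blast
    then show ?thesis using eq[OF lift(1)[OF that(1)] that(2)] that(1) by (simp add: \<psi>'_def)
  qed
  have "dirichlet_char d \<psi>'"
    unfolding dirichlet_char_def
  proof (intro conjI allI d0)
    fix m n
    show "\<psi>' (m * n) = \<psi>' m * \<psi>' n"
    proof (cases "coprime m d \<and> coprime n d")
      case True
      then have "\<psi>' (m * n) = \<psi> (lift m * lift n)"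
        using lift[of m] lift[of n] by (intro \<psi>'_eq cong_mult) auto
      then show ?thesis using True by (simp add: \<psi>'_def char_mult)
    qed (auto simp: \<psi>'_def)
    have cop: "coprime (n + d) d \<longleftrightarrow> coprime n d" by (simp add: coprime_iff_gcd_eq_1)
    show "\<psi>' (n + d) = \<psi>' n"
    proof (cases "coprime n d")
      case True
      then have "\<psi>' (n + d) = \<psi> (lift n)"
        using lift[of n] cop by (intro \<psi>'_eq) (auto simp: cong_def)
      then show ?thesis using True by (simp add: \<psi>'_def)
    qed (auto simp: \<psi>'_def cop)
    show "(\<psi>' n \<noteq> 0) = coprime n d"
      using lift(1)[of n] char_nonzero[of "lift n"] by (auto simp: \<psi>'_def)
  qed
  moreover have "\<psi> n = \<psi>' n * principal_char q n" for n
  proof (cases "coprime n q")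
    case True
    then have "coprime n d" using d(1) coprime_divisors[of n n d q] by simp
    then show ?thesis using True \<psi>'_eq[of n n] by (simp add: principal_char_def)
  qed (use char_nonzero[of n] in \<open>auto simp: principal_char_def\<close>)
  ultimately show False using prim d by (auto simp: primitive_char_def)
qed

definition gauss :: "nat \<Rightarrow> complex" where
  "gauss k = (\<Sum>m<q. \<psi> m * exp (2 * of_real pi * \<i> * of_nat (k * m) / of_nat q))"

lemma root_cong:
  assumes "[m = n] (mod q)"
  shows "exp (2 * of_real pi * \<i> * of_nat m / of_nat q) = exp (2 * of_real pi * \<i> * of_nat n / of_nat q)"
  using complex_root_unity_eq[of q m n] assms q1 by (simp add: cong_def)

lemma sum_mult_residues:
  fixes f :: "nat \<Rightarrow> complex"
  assumes a: "coprime a q" and f: "\<And>m n. [m = n] (mod q) \<Longrightarrow> f m = f n"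
  shows "(\<Sum>m<q. f (a * m)) = (\<Sum>m<q. f m)"
proof -
  have inj: "inj_on (\<lambda>m. a * m mod q) {..<q}"
  proof (rule inj_onI)
    fix x y assume xy: "x \<in> {..<q}" "y \<in> {..<q}" "a * x mod q = a * y mod q"
    then have "[a * x = a * y] (mod q)" by (simp add: cong_def)
    then have "[x = y] (mod q)" using a cong_mult_lcancel_nat by blast
    then show "x = y" using xy by (simp add: cong_def)
  qed
  have "(\<lambda>m. a * m mod q) ` {..<q} = {..<q}"
    using inj q1 by (intro endo_inj_surj) auto
  then have "(\<Sum>m<q. f m) = (\<Sum>m<q. f (a * m mod q))"
    using sum.reindex[OF inj, of f] by (simp add: o_def)
  also have "\<dots> = (\<Sum>m<q. f (a * m))"
    by (intro sum.cong refl f) (simp add: cong_def)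
  finally show ?thesis by simp
qed

text \<open>The substitution m -> am permutes the residues mod q and pulls out the factor
  \<psi>(a).\<close>

lemma gauss_twist:
  assumes "coprime a q"
  shows "\<psi> a * gauss (k * a) = gauss k"
proof -
  let ?f = "\<lambda>m. \<psi> m * exp (2 * of_real pi * \<i> * of_nat (k * m) / of_nat q)"
  have "?f m = ?f n" if "[m = n] (mod q)" for m n
  proof -
    have "[k * m = k * n] (mod q)" using that by (intro cong_mult) auto
    from root_cong[OF this] show ?thesis using char_cong[OF that] by (simp only:)
  qed
  from sum_mult_residues[OF assms, of ?f, OF this]
  show ?thesis
    by (simp add: gauss_def sum_distrib_left char_mult mult_ac)
qed

lemma gauss_cong: "[k = l] (mod q) \<Longrightarrow> gauss k = gauss l"
  unfolding gauss_def by (intro sum.cong refl arg_cong2[where f = "(*)"] root_cong cong_mult) auto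

text \<open>For k prime to q, twist by k itself. Otherwise put d = q / gcd(k,q) and take a = 1 mod d
  with \<psi>(a) different from 1: then ka = k mod q, and twisting by a forces the Gauss sum at k to
  vanish.\<close>

lemma gauss_eq: "gauss k = cnj (\<psi> k) * gauss 1"
proof (cases "coprime k q")
  case True
  have "gauss k = (\<psi> k * cnj (\<psi> k)) * gauss k"
    using norm_char[of k] True by (simp add: complex_mult_cnj flip: cmod_power2)
  also have "\<dots> = cnj (\<psi> k) * gauss 1" using gauss_twist[OF True, of 1] by (simp add: mult_ac)
  finally show ?thesis .
next
  case False
  define g where "g = gcd k q"
  have g: "g dvd k" "g dvd q" "g \<noteq> 1" "g > 0"
    using False q1 by (auto simp: g_def coprime_iff_gcd_eq_1)
  define d where "d = q div g"
  have qd: "q = g * d" using g by (simp add: d_def)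
  have "d dvd q" by (metis qd dvd_triv_right)
  moreover have "d < q" unfolding d_def using g q1 by (intro div_less_dividend) auto
  ultimately obtain a where a: "coprime a q" "[a = 1] (mod d)" "\<psi> a \<noteq> 1" using not_induced by blast
  obtain k' where k': "k = g * k'" using g by blast
  \<comment> \<open>Multiplication by g raises the modulus from d to gd = q.\<close>
  have "[g * a = g * 1] (mod (g * d))"
    using a(2) by (simp add: cong_def mult_mod_right[symmetric])
  then have "[k' * (g * a) = k' * (g * 1)] (mod q)" 
    unfolding qd by (rule cong_mult[OF cong_refl])
  then have "[k * a = k] (mod q)" by (simp add: k' mult_ac)
  then have "\<psi> a * gauss k = gauss k" using gauss_twist[OF a(1), of k] gauss_cong by metis
  then have "gauss k = 0" using a(3) by simp
  moreover have "\<psi> k = 0" using False char_nonzero by blast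
  ultimately show ?thesis by simp
qed

text \<open>Otherwise the whole discrete Fourier transform of \<psi> would vanish by
  \<open>gauss_eq\<close>, contradicting \<psi>(1) = 1 after inversion.\<close>

lemma gauss_1_nonzero: "gauss 1 \<noteq> 0"
proof
  assume "gauss 1 = 0"
  then have zero: "gauss k = 0" for k using gauss_eq[of k] by simp
  let ?z = "\<lambda>j. exp (2 * of_real pi * \<i> * of_nat j / of_nat q)"
  have z_add: "?z (i + j) = ?z i * ?z j" for i j
    by (simp add: exp_add[symmetric] add_divide_distrib ring_distribs)
  have z_pow: "?z (k * j) = ?z j ^ k" for k j
    by (induction k) (simp_all add: z_add del: of_nat_add of_nat_mult of_nat_Suc)
  have orth: "(\<Sum>k<q. ?z (k * j)) = (if q dvd j then of_nat q else 0)" for j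
  proof (cases "q dvd j")
    case True
    then have "?z j = 1" using complex_root_unity_eq_1[of q j] q1 by simp
    then show ?thesis using True unfolding z_pow by simp
  next
    case False
    then have "?z j \<noteq> 1" using complex_root_unity_eq_1[of q j] q1 by simp
    moreover have "?z j ^ q = 1" using complex_root_unity[of q j] q1 by simp
    ultimately show ?thesis using False unfolding z_pow by (simp add: geometric_sum)
  qed
  \<comment> \<open>\<open>q - 1\<close> plays the role of -1 in the exponent, so this is Fourier
    inversion at the residue 1.\<close>
  have "0 = (\<Sum>k<q. gauss k * ?z (k * (q - 1)))" by (simp add: zero)
  also have "\<dots> = (\<Sum>k<q. \<Sum>m<q. \<psi> m * ?z (k * (m + (q - 1))))"
    unfolding gauss_def sum_distrib_right distrib_left z_add by (simp add: mult_ac)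
  also have "\<dots> = (\<Sum>m<q. \<psi> m * (\<Sum>k<q. ?z (k * (m + (q - 1)))))"
    by (subst sum.swap) (simp add: sum_distrib_left)
  also have "\<dots> = (\<Sum>m<q. if m = 1 then of_nat q else 0)"
  proof (rule sum.cong[OF refl])
    fix m assume m: "m \<in> {..<q}"
    have "q dvd m + (q - 1) \<longleftrightarrow> m = 1"
    proof
      assume "q dvd m + (q - 1)"
      then obtain c where c: "m + (q - 1) = q * c" by blast
      have "c < 2"
      proof (rule ccontr)
        assume "\<not> c < 2"
        then have "q * 2 \<le> q * c" by simp
        moreover have "m < q" using m by simp
        ultimately show False using c q1 by linarith
      qed
      moreover have "c \<noteq> 0"
      proof
        assume "c = 0"
        then have "m + (q - 1) = 0" using c by simp
        then show False using q1 by linarith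
      qed
      ultimately have "c = 1" by simp
      then show "m = 1" using c q1 by simp
    qed (use q1 in auto)
    then show "\<psi> m * (\<Sum>k<q. ?z (k * (m + (q - 1)))) = (if m = 1 then of_nat q else 0)"
      unfolding orth by (simp add: char_1)
  qed
  also have "\<dots> = of_nat q" using q1 by simp
  finally show False using q1 by simp
qed

end

section \<open>The sine coefficients of S_1 for even characters\<close>

lemma LINT_step_mult_sin:
  assumes a: "0 < a" "a < 1" and k: "k > 0"
  shows "integrable I01 (\<lambda>x. if a < x \<and> x < 1 then sin (pi * (real k * x)) else 0)"
    "(LINT x|I01. (if a < x \<and> x < 1 then sin (pi * (real k * x)) else 0)) =
      (cos (pi * (real k * a)) - cos (pi * real k)) / (pi * real k)"
proof -
  let ?f = "\<lambda>x. if a < x \<and> x < 1 then sin (pi * (real k * x)) else 0"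
  have f: "?f \<in> borel_measurable borel" by measurable
  have le: "norm (?f x) \<le> 1" for x by auto
  show "integrable I01 ?f" by (rule LINT_I01_eq_integral(1)[OF f le])
  have "((\<lambda>x. sin (pi * (real k * x))) has_integral
     (- cos (pi * (real k * 1)) / (pi * real k) - - cos (pi * (real k * a)) / (pi * real k))) {a..1}"
    using a k by (intro fundamental_theorem_of_calculus)
      (auto intro!: derivative_eq_intros simp flip: has_real_derivative_iff_has_vector_derivative)
  then have "((\<lambda>x. sin (pi * (real k * x))) has_integral
      (cos (pi * (real k * a)) - cos (pi * real k)) / (pi * real k)) {a<..<1}"
    by (simp add: has_integral_Icc_iff_Ioo diff_divide_distrib)
  then have "((\<lambda>x. if x \<in> {a<..<1} then sin (pi * (real k * x)) else 0) has_integral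
      (cos (pi * (real k * a)) - cos (pi * real k)) / (pi * real k)) {0..1}"
    using a by (subst has_integral_restrict) auto
  then have "integral {0..1} ?f = (cos (pi * (real k * a)) - cos (pi * real k)) / (pi * real k)"
    by (intro integral_unique) simp
  then show "(LINT x|I01. ?f x) = (cos (pi * (real k * a)) - cos (pi * real k)) / (pi * real k)"
    by (subst LINT_I01_eq_integral(2)[OF f le])
qed

locale even_prim_char = prim_char +
  assumes even_char: "\<psi> (q - 1) = 1"
begin

lemma char_minus:
  assumes "m \<le> q"
  shows "\<psi> (q - m) = \<psi> m"
proof (cases m)
  case 0 then show ?thesis using char_period[of 0] by simp
next
  case (Suc m')
  obtain r where r: "q = m + r" using assms le_Suc_ex by blast
  have "(q - 1) * m = (q - m) + m' * q"
    by (simp add: r Suc algebra_simps)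
  then have "[(q - 1) * m = q - m] (mod q)" by (simp add: cong_def)
  from char_cong[OF this] show ?thesis by (simp only: char_mult even_char mult_1)
qed

text \<open>q/2 divides q, so it can be prime to q only for q = 2; but there is no primitive
  character mod 2, as all its units are congruent to 1.\<close>

lemma char_half:
  assumes "even q"
  shows "\<psi> (q div 2) = 0"
proof (rule ccontr)
  assume "\<psi> (q div 2) \<noteq> 0"
  then have "coprime (q div 2) q" by (simp only: char_nonzero not_False_eq_True)
  moreover have "q div 2 dvd q" using assms by auto
  ultimately have "q div 2 = 1" by (metis coprime_common_divisor_nat dvd_refl)
  then have q: "q = 2" using assms by auto
  obtain a where a: "coprime a q" "\<psi> a \<noteq> 1" using not_induced[of 1] q1 by auto
  then have "odd a" using q by simp
  then have "[a = 1] (mod q)" by (simp add: q cong_def odd_iff_mod_2_eq_one)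
  then show False using char_cong[of a 1] a char_1 by simp
qed

text \<open>The residues pair up as m and q - m; the only ones left over are 0 and, for even q, the
  midpoint q/2.\<close>

lemma sum_half:
  fixes h :: "nat \<Rightarrow> complex"
  assumes sym: "\<And>m. 0 < m \<Longrightarrow> m < q \<Longrightarrow> h (q - m) = h m"
    and 0: "h 0 = 0" and half: "even q \<Longrightarrow> h (q div 2) = 0"
  shows "(\<Sum>m<q. h m) = 2 * (\<Sum>m\<in>{1..(q - 1) div 2}. h m)"
proof -
  let ?A = "{1..(q - 1) div 2}"
  let ?B = "(\<lambda>m. q - m) ` ?A"
  have inj: "inj_on (\<lambda>m. q - m) ?A"
    by (rule inj_onI) auto
  have "(\<Sum>m<q. h m) = sum h (?A \<union> ?B)"
  proof (rule sum.mono_neutral_right)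
    show "?A \<union> ?B \<subseteq> {..<q}" using q1 by auto
    show "\<forall>x\<in>{..<q} - (?A \<union> ?B). h x = 0"
    proof
      fix x assume x: "x \<in> {..<q} - (?A \<union> ?B)"
      show "h x = 0"
      proof (cases "x = 0")
        case False
        have "q - x \<notin> ?A"
        proof
          assume "q - x \<in> ?A"
          then have "q - (q - x) \<in> ?B" by (rule imageI)
          then show False using x by simp
        qed
        then have "2 * x = q" using x False by auto
        then show ?thesis using half by auto
      qed (use 0 in simp)
    qed
  qed simp
  also have "\<dots> = sum h ?A + sum h ?B"
    by (rule sum.union_disjoint) auto
  also have "sum h ?B = (\<Sum>m\<in>?A. h (q - m))"
    unfolding sum.reindex[OF inj] o_def ..
  also have "\<dots> = sum h ?A"
    by (intro sum.cong refl sym) auto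
  finally show ?thesis by simp
qed

text \<open>This sum is the Gauss sum at 0, where \<psi> vanishes because q > 1.\<close>

lemma sum_char: "(\<Sum>m<q. \<psi> m) = 0"
  using gauss_eq[of 0] by (simp add: gauss_def char_0)

lemma sum_char_half: "(\<Sum>m\<in>{1..(q - 1) div 2}. \<psi> m) = 0"
  using sum_half[of \<psi>] char_minus char_0 char_half sum_char by simp

text \<open>Evenness allows averaging the exponentials at m and q - m, and their imaginary parts
  cancel.\<close>

lemma gauss_cos: "gauss k = (\<Sum>m<q. \<psi> m * of_real (cos (pi * (real k * (2 * real m / real q)))))"
proof -
  let ?e = "\<lambda>m. exp (2 * of_real pi * \<i> * of_nat (k * m) / of_nat q)"
  let ?t = "\<lambda>m. pi * (real k * (2 * real m / real q))"
  have e: "?e m = cis (?t m)" for m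
    by (simp add: cis_conv_exp field_simps)
  have e': "?e (q - m) = cis (- ?t m)" if "m < q" for m
  proof -
    have "?e (q - m) * ?e m = ?e q"
      using that by (simp add: exp_add[symmetric] of_nat_diff diff_divide_distrib algebra_simps)
    also have "?e q = 1" using root_cong[of "k * q" 0] by (simp add: cong_def)
    finally have "?e (q - m) = inverse (cis (?t m))"
      unfolding e by (metis inverse_unique mult.commute)
    then show ?thesis by simp
  qed
  \<comment> \<open>The reflection m -> q - m preserves this range; the remaining residue 0
    contributes nothing.\<close>
  have "(\<Sum>m\<in>{1..<q}. \<psi> m * ?e m) = (\<Sum>m\<in>{1..<q}. \<psi> (q - m) * ?e (q - m))"
    by (rule sum.reindex_bij_witness[of _ "\<lambda>m. q - m" "\<lambda>m. q - m"]) auto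
  also have "\<dots> = (\<Sum>m\<in>{1..<q}. \<psi> m * cis (- ?t m))"
    by (intro sum.cong refl arg_cong2[where f = "(*)"] e' char_minus) auto
  finally have 1: "(\<Sum>m\<in>{1..<q}. \<psi> m * cis (?t m)) = (\<Sum>m\<in>{1..<q}. \<psi> m * cis (- ?t m))"
    by (simp only: e)
  have "cis t + cis (- t) = 2 * of_real (cos t)" for t by (simp add: complex_eq_iff)
  then have "(\<Sum>m\<in>{1..<q}. \<psi> m * cis (?t m)) + (\<Sum>m\<in>{1..<q}. \<psi> m * cis (- ?t m)) =
      2 * (\<Sum>m\<in>{1..<q}. \<psi> m * of_real (cos (?t m)))"
    by (simp only: sum.distrib[symmetric] distrib_left[symmetric] sum_distrib_left mult.left_commute)
  then have 2: "(\<Sum>m\<in>{1..<q}. \<psi> m * cis (?t m)) = (\<Sum>m\<in>{1..<q}. \<psi> m * of_real (cos (?t m)))"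
    using 1 by simp
  have split: "(\<Sum>m<q. \<psi> m * f m) = (\<Sum>m\<in>{1..<q}. \<psi> m * f m)" for f
  proof (rule sum.mono_neutral_right)
    show "\<forall>i\<in>{..<q} - {1..<q}. \<psi> i * f i = 0"
    proof
      fix i assume "i \<in> {..<q} - {1..<q}"
      then have "i = 0" by (cases i) auto
      then show "\<psi> i * f i = 0" by (simp add: char_0)
    qed
  qed auto
  show ?thesis unfolding gauss_def split e using 2 .
qed

lemma gauss_half:
  "(\<Sum>m\<in>{1..(q - 1) div 2}. \<psi> m * of_real (cos (pi * (real k * (2 * real m / real q))))) = gauss k / 2"
proof -
  let ?h = "\<lambda>m. \<psi> m * complex_of_real (cos (pi * (real k * (2 * real m / real q))))"
  have "?h (q - m) = ?h m" if "m < q" for m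
  proof -
    have "pi * (real k * (2 * real (q - m) / real q)) = real k * (2 * pi) - pi * (real k * (2 * real m / real q))"
      using that by (simp add: of_nat_diff field_simps)
    then have "cos (pi * (real k * (2 * real (q - m) / real q))) = cos (pi * (real k * (2 * real m / real q)))"
      using cos.plus_of_nat[of "- (pi * (real k * (2 * real m / real q)))" k] by simp
    then show ?thesis using char_minus[of m] that by simp
  qed
  then have "(\<Sum>m<q. ?h m) = 2 * (\<Sum>m\<in>{1..(q - 1) div 2}. ?h m)"
    by (intro sum_half) (simp_all add: char_0 char_half)
  then show ?thesis unfolding gauss_cos by simp
qed

abbreviation S :: "nat \<Rightarrow> real \<Rightarrow> complex" where
  "S n \<equiv> odd_ext (S_fun \<psi> q n)"

lemma S_fun_measurable [measurable]: "S_fun \<psi> q n \<in> borel_measurable borel"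
  unfolding S_fun_def by measurable

lemma norm_S_fun_le: "norm (S_fun \<psi> q n x) \<le> (\<Sum>m\<in>{m\<in>{1..(n * q - 1) div 2}. coprime m n}. norm (\<psi> m))"
  unfolding S_fun_def by (rule sum_norm_le) (auto simp: norm_mult)

lemma S_fun_L2: "S_fun \<psi> q n \<in> L2_01"
  using norm_S_fun_le by (intro bounded_in_L2_01) auto

lemma S_periodic_odd: "S n \<in> periodic_odd"
  using norm_S_fun_le by (intro periodic_odd_odd_ext) auto

text \<open>A step at a contributes (cos(pi k a) - cos(pi k)) / (pi k). The second cosine is
  multiplied by the half sum of \<psi>, which is 0, and the first ones add up to half the Gauss sum
  at k. For k = 0 both sides are 0, division by zero giving 0.\<close>

lemma coef_S_1: "coef (S 1) k = gauss 1 / of_real pi * (cnj (\<psi> k) / of_nat k)"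
proof (cases "k = 0")
  case True then show ?thesis by (simp add: coef_def sn_def)
next
  case False
  then have k: "k > 0" by simp
  let ?A = "{1..(q - 1) div 2}"
  let ?a = "\<lambda>m. 2 * real m / real q"
  let ?g = "\<lambda>m x. if ?a m < x \<and> x < 1 then sin (pi * (real k * x)) else 0"
  have a: "0 < ?a m" "?a m < 1" if "m \<in> ?A" for m
    using that q1 by (auto simp: field_simps)
  have "(LINT x|I01. S 1 x * sn k x) = (LINT x|I01. (\<Sum>m\<in>?A. \<psi> m * complex_of_real (?g m x)))"
  proof (rule Bochner_Integration.integral_cong[OF refl])
    fix x assume "x \<in> space I01"
    then have x: "0 < x" "x < 1" by (auto simp: space_restrict_space)
    show "S 1 x * sn k x = (\<Sum>m\<in>?A. \<psi> m * complex_of_real (?g m x))"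
      unfolding odd_ext_eq[OF x] S_fun_def sum_distrib_right
      by (intro sum.cong) (auto simp: sn_def)
  qed
  also have "\<dots> = (\<Sum>m\<in>?A. (LINT x|I01. \<psi> m * complex_of_real (?g m x)))"
    by (rule Bochner_Integration.integral_sum)
       (rule integrable_mult_right, rule integrable_of_real, rule LINT_step_mult_sin(1)[OF a k])
  also have "\<dots> = (\<Sum>m\<in>?A. \<psi> m * complex_of_real (LINT x|I01. ?g m x))"
    by (simp only: integral_mult_right_zero integral_complex_of_real)
  also have "\<dots> = (\<Sum>m\<in>?A. \<psi> m * complex_of_real ((cos (pi * (real k * ?a m)) - cos (pi * real k)) / (pi * real k)))"
    using LINT_step_mult_sin(2)[OF a k] by (intro sum.cong refl) (simp only:)
  also have "\<dots> = ((\<Sum>m\<in>?A. \<psi> m * of_real (cos (pi * (real k * ?a m)))) -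
      of_real (cos (pi * real k)) * (\<Sum>m\<in>?A. \<psi> m)) / of_real (pi * real k)"
    by (simp only: of_real_divide of_real_diff right_diff_distrib diff_divide_distrib sum_subtractf
        times_divide_eq_right sum_divide_distrib[symmetric] sum_distrib_left mult.commute)
  also have "\<dots> = gauss k / 2 / of_real (pi * real k)"
    unfolding gauss_half sum_char_half by simp
  finally show ?thesis using gauss_eq[of k] by (simp add: coef_def field_simps)
qed

lemma has_coeffs_S_1: "has_coeffs (S 1) (\<lambda>k. gauss 1 / of_real pi * (cnj (\<psi> k) / of_nat k))"
  using has_coeffs_coef[OF S_periodic_odd[of 1]] unfolding coef_S_1[abs_def] .

theorem sn_1_mem_of_S_1:
  assumes "dilation_invariant M" "S 1 \<in> M"
  shows "sn 1 \<in> M"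
proof -
  interpret dilation_invariant M by fact
  show ?thesis
  proof (rule sn_1_mem[OF has_coeffs_S_1 assms(2)])
    show "gauss 1 / of_real pi \<noteq> 0" using gauss_1_nonzero by simp
    show "norm (cnj (\<psi> k) / of_nat k) \<le> 1 / real k" if "k > 0" for k
      using norm_char_le_1[of k] that by (simp add: norm_divide divide_right_mono)
  qed (simp_all add: char_mult char_1)
qed

end

section \<open>The recursion for $S_n$\<close>

context even_prim_char
begin

text \<open>The sieved character sum without the cutoff (nq-1)/2 of \<open>S_fun\<close>: evaluated
  at the floor of nqx/2 it describes the odd periodic extension on all positive irrationals, so that
  dilation is mere substitution.\<close>

definition psum :: "nat \<Rightarrow> nat \<Rightarrow> complex" where
  "psum n N = (\<Sum>m\<in>{m\<in>{1..N}. coprime m n}. \<psi> m)"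

lemma psum_1: "psum 1 N = (\<Sum>m\<in>{1..N}. \<psi> m)"
  unfolding psum_def by (rule sum.cong) auto

lemma psum_1_Suc: "psum 1 (Suc N) = psum 1 N + \<psi> (Suc N)"
  unfolding psum_1 by simp

lemma psum_1_0: "psum 1 0 = 0"
  unfolding psum_1 by simp

lemma psum_1_period: "psum 1 (N + k * q) = psum 1 N"
proof -
  have step: "psum 1 (N + q) = psum 1 N" for N
  proof (induction N)
    case 0
    have "psum 1 q = (\<Sum>m<Suc q. \<psi> m) - \<psi> 0"
      unfolding psum_1 lessThan_Suc_atMost by (subst sum.atMost_shift) (simp add: sum.atLeast_Suc_atMost_Suc_shift sum.atLeast1_atMost_eq)
    then show ?case using sum_char char_period[of 0] char_0 psum_1_0 by simp
  next
    case (Suc N)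
    then show ?case using psum_1_Suc[of N] psum_1_Suc[of "N + q"] char_period[of "Suc N"] by simp
  qed
  show ?thesis
  proof (induction k)
    case (Suc k)
    then show ?case using step[of "N + k * q"] by (simp add: algebra_simps)
  qed simp
qed

text \<open>The full sum is 0 and, by evenness, the last N terms before q add up to the first N.
  This is the oddness of S_1 about the point x = 1.\<close>

lemma psum_1_reflect: "N < q \<Longrightarrow> psum 1 (q - 1 - N) = - psum 1 N"
proof (induction N)
  case 0
  have "psum 1 q = 0" using psum_1_period[of 0 1] psum_1_0 by simp
  moreover have "psum 1 q = psum 1 (q - 1) + \<psi> q" using psum_1_Suc[of "q - 1"] q1 by simp
  ultimately show ?case using char_period[of 0] char_0 psum_1_0 by simp
next
  case (Suc N)
  have "q - 1 - N = Suc (q - 1 - Suc N)" using Suc.prems by simp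
  then have "psum 1 (q - 1 - N) = psum 1 (q - 1 - Suc N) + \<psi> (q - Suc N)"
    using psum_1_Suc[of "q - 1 - Suc N"] by simp
  moreover have "\<psi> (q - Suc N) = \<psi> (Suc N)" using Suc.prems by (intro char_minus) simp
  moreover have "psum 1 (q - 1 - N) = - psum 1 N" using Suc by simp
  ultimately have "psum 1 (q - 1 - Suc N) = - psum 1 N - \<psi> (Suc N)" by (simp add: eq_diff_eq)
  then show ?case using psum_1_Suc[of N] by simp
qed

lemma irrational_mult:
  assumes "x \<notin> \<rat>" "n > 0"
  shows "real n * x \<notin> \<rat>"
proof
  assume "real n * x \<in> \<rat>"
  then have "real n * x / real n \<in> \<rat>" by (intro Rats_divide) auto
  then show False using assms by simp
qed

text \<open>At irrational x the strict condition 2m/(nq) < x is the same as m <= floor(nqx/2), and x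
  < 1 already implies the cutoff on m.\<close>

lemma S_fun_eq_psum:
  assumes x: "0 < x" "x < 1" "x \<notin> \<rat>" and n: "n > 0"
  shows "S_fun \<psi> q n x = psum n (nat \<lfloor>real (n * q) * x / 2\<rfloor>)"
proof -
  have nq: "n * q > 0" using n q1 by simp
  define t where "t = real (n * q) * x / 2"
  have tq: "t \<notin> \<rat>"
  proof
    assume "t \<in> \<rat>"
    then have "t * 2 \<in> \<rat>" by (intro Rats_mult) auto
    then show False using irrational_mult[OF x(3) nq] by (simp add: t_def)
  qed
  have iff: "2 * real m / real (n * q) < x \<longleftrightarrow> m \<le> nat \<lfloor>t\<rfloor>" for m
  proof -
    have "2 * real m / real (n * q) < x \<longleftrightarrow> real m < t"
      using nq by (simp add: t_def field_simps)
    also have "\<dots> \<longleftrightarrow> real m \<le> t" using tq by (cases "real m = t") auto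
    also have "\<dots> \<longleftrightarrow> m \<le> nat \<lfloor>t\<rfloor>" using x by (subst le_nat_iff) (simp_all add: t_def le_floor_iff)
    finally show ?thesis .
  qed
  have le: "m \<le> (n * q - 1) div 2" if "m \<le> nat \<lfloor>t\<rfloor>" for m
  proof -
    have "2 * real m < real (n * q) * x"
      using that iff[of m] nq by (simp add: field_simps)
    also have "\<dots> < real (n * q) * 1" using x nq by (intro mult_strict_left_mono) auto
    finally have "real (2 * m) < real (n * q)" by simp
    then have "2 * m < n * q" by (simp only: of_nat_less_iff)
    then show ?thesis by simp
  qed
  have "S_fun \<psi> q n x = (\<Sum>m\<in>{m\<in>{1..(n * q - 1) div 2}. coprime m n}. if m \<le> nat \<lfloor>t\<rfloor> then \<psi> m else 0)"
    unfolding S_fun_def iff using x by (intro sum.cong refl) simp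
  also have "\<dots> = psum n (nat \<lfloor>t\<rfloor>)"
    unfolding psum_def by (rule sum.mono_neutral_cong_right) (use le in auto)
  finally show ?thesis by (simp add: t_def)
qed

text \<open>Shifting x by 2 moves the summation bound by the period q; passing from y in (1,2) to 2
  - y reflects the bound N to q - 1 - N and changes the sign.\<close>

lemma S_1_eq_psum:
  assumes x: "x > 0" "x \<notin> \<rat>"
  shows "S 1 x = psum 1 (nat \<lfloor>real (1 * q) * x / 2\<rfloor>)"
proof -
  define j where "j = nat \<lfloor>x / 2\<rfloor>"
  define y where "y = x - 2 * real j"
  have j: "\<lfloor>x / 2\<rfloor> = int j" using x by (simp add: j_def)
  have yq: "y \<notin> \<rat>"
  proof
    assume "y \<in> \<rat>"
    then have "y + 2 * real j \<in> \<rat>" by (intro Rats_add Rats_mult) auto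
    then show False using x by (simp add: y_def)
  qed
  have "y \<noteq> 0" "y \<noteq> 1" using yq by auto
  moreover have "0 \<le> y" "y < 2" using j unfolding y_def by linarith+
  ultimately consider "0 < y" "y < 1" | "1 < y" "y < 2" by linarith
  note cases = this
  define N where "N = nat \<lfloor>real q * y / 2\<rfloor>"
  have y0: "0 \<le> real q * y / 2" using \<open>0 \<le> y\<close> by simp
  have "real (1 * q) * x / 2 = real q * y / 2 + of_int (int (j * q))"
    by (simp add: y_def field_simps)
  then have "\<lfloor>real (1 * q) * x / 2\<rfloor> = \<lfloor>real q * y / 2\<rfloor> + int (j * q)"
    by (simp only: floor_add_int)
  then have "nat \<lfloor>real (1 * q) * x / 2\<rfloor> = N + j * q"
    using y0 by (simp add: N_def nat_add_distrib nat_mult_distrib)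
  then have rhs: "psum 1 (nat \<lfloor>real (1 * q) * x / 2\<rfloor>) = psum 1 N"
    by (simp only: psum_1_period)
  have S: "S 1 x = (if 0 < y \<and> y < 1 then S_fun \<psi> q 1 y
      else if 1 < y \<and> y < 2 then - S_fun \<psi> q 1 (2 - y) else 0)"
    by (simp only: odd_ext_def Let_def j y_def of_int_of_nat_eq)
  show ?thesis
  proof (cases rule: cases)
    case 1
    then have "S_fun \<psi> q 1 y = psum 1 N"
      using S_fun_eq_psum[of y 1] yq by (simp add: N_def)
    then show ?thesis unfolding S rhs using 1 by simp
  next
    case 2
    have "2 - y \<notin> \<rat>" using yq Rats_diff[of 2 "2 - y"] by auto
    then have *: "S_fun \<psi> q 1 (2 - y) = psum 1 (nat \<lfloor>real q * (2 - y) / 2\<rfloor>)"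
      using S_fun_eq_psum[of "2 - y" 1] 2 by simp
    have Nq: "N < q"
    proof -
      have "real q * y / 2 < real q" using 2 q1 by simp
      then show ?thesis using y0 unfolding N_def by linarith
    qed
    have notint: "real q * y / 2 \<noteq> of_int i" for i
    proof
      assume "real q * y / 2 = of_int i"
      then have "real q * y = of_int (2 * i)" by simp
      then have "real q * y \<in> \<rat>" by (metis Rats_of_int)
      then show False using irrational_mult[OF yq, of q] q1 by simp
    qed
    have fl: "\<lfloor>real q * y / 2\<rfloor> = int N" using y0 by (simp add: N_def)
    \<comment> \<open>The -1 arises because qy/2 is not an integer: the floor of q - t is then q - 1
      - floor(t).\<close>
    have "\<lfloor>real q * (2 - y) / 2\<rfloor> = int q - 1 - int N"
    proof (rule floor_unique)
      have "of_int (int N) < real q * y / 2" "real q * y / 2 < of_int (int N) + 1"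
        using fl notint[of "int N"] by linarith+
      then show "of_int (int q - 1 - int N) \<le> real q * (2 - y) / 2"
        "real q * (2 - y) / 2 < of_int (int q - 1 - int N) + 1"
        by (simp_all add: field_simps)
    qed
    then have "nat \<lfloor>real q * (2 - y) / 2\<rfloor> = q - 1 - N" using Nq by simp
    then have "S_fun \<psi> q 1 (2 - y) = - psum 1 N" using * psum_1_reflect[OF Nq] by simp
    then show ?thesis unfolding S rhs using 2 by simp
  qed
qed

text \<open>The m <= N prime to n split into those not divisible by p and the multiples pk with k <=
  N div p, on which \<psi>(pk) = \<psi>(p)\<psi>(k). If p already divides n, no further m is
  excluded.\<close>

lemma psum_prime_mult:
  assumes p: "prime p"
  shows "psum (p * n) N = psum n N - (if p dvd n then 0 else \<psi> p) * psum n (N div p)"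
proof (cases "p dvd n")
  case True
  then have "coprime m (p * n) \<longleftrightarrow> coprime m n" for m
    by (metis coprime_common_divisor coprime_mult_right_iff dvd_mult not_prime_unit p prime_imp_coprime coprime_commute)
  then show ?thesis using True by (simp add: psum_def)
next
  case False
  have p0: "p > 0" using p prime_gt_0_nat by blast
  have cop: "coprime m (p * n) \<longleftrightarrow> coprime m n \<and> \<not> p dvd m" for m
    using p by (metis coprime_commute coprime_mult_right_iff prime_imp_coprime coprime_common_divisor dvd_refl not_prime_unit)
  let ?A = "{m\<in>{1..N}. coprime m (p * n)}" and ?B = "(*) p ` {m\<in>{1..N div p}. coprime m n}"
  have pn: "coprime p n" using p False prime_imp_coprime by blast
  have "{m\<in>{1..N}. coprime m n} = ?A \<union> ?B"
  proof (intro equalityI subsetI)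
    fix m assume m: "m \<in> {m\<in>{1..N}. coprime m n}"
    show "m \<in> ?A \<union> ?B"
    proof (cases "p dvd m")
      case True
      then obtain k where k: "m = p * k" by blast
      have "k \<in> {m\<in>{1..N div p}. coprime m n}"
        using m k p0 div_le_mono[of m N p] by (auto intro: Suc_leI Nat.gr0I)
      then show ?thesis using k by blast
    qed (use m cop in auto)
  next
    fix m assume "m \<in> ?A \<union> ?B"
    then show "m \<in> {m\<in>{1..N}. coprime m n}"
    proof
      assume "m \<in> ?B"
      then obtain k where k: "m = p * k" "1 \<le> k" "k \<le> N div p" "coprime k n" by auto
      have "p * k \<le> p * (N div p)" using k by simp
      also have "\<dots> \<le> N" by simp
      finally show ?thesis using k p0 pn by auto
    qed (auto simp: cop)
  qed
  moreover have "?A \<inter> ?B = {}"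
  proof -
    have "\<not> p dvd m" if "m \<in> ?A" for m using that cop by blast
    moreover have "p dvd m" if "m \<in> ?B" for m using that by auto
    ultimately show ?thesis by blast
  qed
  ultimately have "psum n N = (\<Sum>m\<in>?A. \<psi> m) + (\<Sum>m\<in>?B. \<psi> m)"
    unfolding psum_def by (simp add: sum.union_disjoint)
  also have "(\<Sum>m\<in>?B. \<psi> m) = \<psi> p * psum n (N div p)"
    unfolding psum_def sum_distrib_left
    using p0 by (subst sum.reindex) (auto simp: inj_on_def char_mult)
  finally show ?thesis using False by (simp add: psum_def)
qed

definition step_coeff :: "nat \<Rightarrow> nat \<Rightarrow> complex" where
  "step_coeff p n = (if p dvd n then 0 else \<psi> p)"

text \<open>The formula on positive irrationals and the recursion support each other: from the
  formula at n the right side is computed at pn, and the recursion then carries the formula over to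
  S_{pn}. Periodicity and reflection of character sums are thus needed for n = 1 only.\<close>

lemma S_prime_mult_aux:
  assumes p: "prime p" and n: "n > 0"
    and IH: "\<And>x. x > 0 \<Longrightarrow> x \<notin> \<rat> \<Longrightarrow> S n x = psum n (nat \<lfloor>real (n * q) * x / 2\<rfloor>)"
  shows "\<And>x. x > 0 \<Longrightarrow> x \<notin> \<rat> \<Longrightarrow>
      dil p (S n) x - step_coeff p n * S n x = psum (p * n) (nat \<lfloor>real (p * n * q) * x / 2\<rfloor>)"
    and "\<And>x. x \<notin> \<rat> \<Longrightarrow> S (p * n) x = dil p (S n) x - step_coeff p n * S n x"
proof -
  have p0: "p > 0" using p prime_gt_0_nat by blast
  show eq: "dil p (S n) x - step_coeff p n * S n x = psum (p * n) (nat \<lfloor>real (p * n * q) * x / 2\<rfloor>)"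
    if x: "x > 0" "x \<notin> \<rat>" for x
  proof -
    let ?N = "nat \<lfloor>real (p * n * q) * x / 2\<rfloor>"
    have "dil p (S n) x = psum n ?N"
      using IH[of "real p * x"] x p0 irrational_mult[OF x(2) p0] by (simp add: dil_def mult_ac)
    moreover have "S n x = psum n (?N div p)"
    proof -
      \<comment> \<open>Dividing the bound by p and taking the floor is integer division of the
        floor, which is the N div p of the sieve.\<close>
      have "real (n * q) * x / 2 = (real (p * n * q) * x / 2) / real p" using p0 by simp
      then have "\<lfloor>real (n * q) * x / 2\<rfloor> = \<lfloor>real (p * n * q) * x / 2\<rfloor> div int p"
        using floor_divide_real_eq_div[OF of_nat_0_le_iff[of p], of "real (p * n * q) * x / 2"]
        by (simp only: of_int_of_nat_eq)
      then have "nat \<lfloor>real (n * q) * x / 2\<rfloor> = ?N div p"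
        using x by (simp add: nat_div_distrib)
      then show ?thesis using IH[OF x] by simp
    qed
    ultimately show ?thesis using psum_prime_mult[OF p, of n ?N] by (simp add: step_coeff_def)
  qed
  show "S (p * n) x = dil p (S n) x - step_coeff p n * S n x" if x: "x \<notin> \<rat>" for x
  \<comment> \<open>The right side is odd and 2-periodic, so a comparison with \<open>S_fun\<close>
    at irrational points of (0,1) suffices.\<close>
  proof (rule odd_ext_unique[OF _ _ _ x])
    have V: "(\<lambda>x. dil p (S n) x - step_coeff p n * S n x) \<in> periodic_odd"
      by (intro periodic_odd_diff periodic_odd_scale periodic_odd_dil S_periodic_odd)
    show "dil p (S n) (- x) - step_coeff p n * S n (- x) = - (dil p (S n) x - step_coeff p n * S n x)" for x
      using periodic_odd_minus[OF V] .
    show "dil p (S n) (x + 2) - step_coeff p n * S n (x + 2) = dil p (S n) x - step_coeff p n * S n x" for x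
      using periodic_odd_period[OF V] .
    show "S_fun \<psi> q (p * n) x = dil p (S n) x - step_coeff p n * S n x"
      if "0 < x" "x < 1" "x \<notin> \<rat>" for x
      using that eq[of x] S_fun_eq_psum[of x "p * n"] p0 n by simp
  qed
qed

lemma S_eq_psum:
  assumes "n > 0" "x > 0" "x \<notin> \<rat>"
  shows "S n x = psum n (nat \<lfloor>real (n * q) * x / 2\<rfloor>)"
  using assms
proof (induction n arbitrary: x rule: less_induct)
  case (less n)
  show ?case
  proof (cases "n = 1")
    case True then show ?thesis using S_1_eq_psum[of x] less.prems by simp
  next
    case False
    then obtain p where p: "prime p" "p dvd n" using prime_factor_nat by blast
    then obtain m where m: "n = p * m" by blast
    have mn: "m < n" "m > 0" using m less.prems p prime_gt_1_nat[of p] by auto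
    show ?thesis
      using S_prime_mult_aux[OF p(1) mn(2) less.IH[OF mn]] less.prems unfolding m by simp
  qed
qed

lemma S_prime_mult:
  assumes "prime p" "n > 0" "x \<notin> \<rat>"
  shows "S (p * n) x = dil p (S n) x - step_coeff p n * S n x"
  using S_prime_mult_aux(2)[OF assms(1,2) S_eq_psum[OF assms(2)]] assms(3) by blast

text \<open>Writing v = pw, squarefreeness gives S_v = (T_p - \<psi>(p)) S_w, and coprimality to q
  gives |\<psi>(p)| = 1, so \<open>cesaro\<close> removes one prime at a time.\<close>

lemma S_1_mem_of_squarefree:
  assumes M: "dilation_invariant M" and v: "v > 0" "squarefree v" "coprime v q" "S v \<in> M"
  shows "S 1 \<in> M"
  using v
proof (induction v rule: less_induct)
  case (less v)
  interpret dilation_invariant M by fact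
  show ?case
  proof (cases "v = 1")
    case True then show ?thesis using less.prems by simp
  next
    case False
    then obtain p where p: "prime p" "p dvd v" using prime_factor_nat by blast
    then obtain w where w: "v = p * w" by blast
    have wv: "w < v" "w > 0" using w less.prems p prime_gt_1_nat[of p] by auto
    have pw: "\<not> p dvd w"
    proof
      assume "p dvd w"
      then have "p^2 dvd v" by (simp add: w power2_eq_square)
      then show False using less.prems(2) p(1) unfolding squarefree_def by (metis not_prime_unit)
    qed
    have cop: "coprime p q" "coprime w q" using less.prems(3) by (auto simp: w)
    have sqf: "squarefree w" using less.prems(2) w squarefree_mono[of w v] by auto
    have nz: "\<psi> p \<noteq> 0" using cop char_nonzero by blast
    have "nrm (\<lambda>x. (dil p (S w) x - \<psi> p * S w x) - S v x) = 0"
      using S_prime_mult[OF p(1) wv(2)] pw by (intro nrm_eq_0_ae) (simp add: w step_coeff_def)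
    then have "(\<lambda>x. dil p (S w) x - \<psi> p * S w x) \<in> M"
      by (intro nrm_eq_0[OF less.prems(4)] periodic_odd_diff periodic_odd_scale periodic_odd_dil S_periodic_odd)
    \<comment> \<open>Normalizes T_p - \<psi>(p) to 1 - cT_p with c = 1/\<psi>(p).\<close>
    from scale[OF this, of "- 1 / \<psi> p"]
    have "(\<lambda>x. - 1 / \<psi> p * (dil p (S w) x - \<psi> p * S w x)) \<in> M" .
    also have "(\<lambda>x. - 1 / \<psi> p * (dil p (S w) x - \<psi> p * S w x)) = (\<lambda>x. S w x - (1 / \<psi> p) * dil p (S w) x)"
      using nz by (simp add: fun_eq_iff field_simps)
    finally have "(\<lambda>x. S w x - (1 / \<psi> p) * dil p (S w) x) \<in> M" .
    moreover have "norm (1 / \<psi> p) \<le> 1" using cop norm_char[of p] by (simp add: norm_divide)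
    ultimately have "S w \<in> M"
      using cesaro[OF prime_ge_2_nat[OF p(1)] _ S_periodic_odd] by blast
    then show ?thesis using less.IH[OF wv(1)] wv(2) sqf cop(2) by simp
  qed
qed

end

section \<open>Linear combinations of the $S_d$\<close>

text \<open>The number of squarefree divisors of $d$ prime to $q$: by the recursion for $S_{pn}$ it is the sum of
  the absolute values of the coefficients when $S_d$ is written through dilates of $S_1$.\<close>

definition twist_weight :: "nat \<Rightarrow> nat \<Rightarrow> nat" where
  "twist_weight q d = 2 ^ card {p \<in> prime_factors d. \<not> p dvd q}"

lemma twist_weight_1: "twist_weight q 1 = 1"
  by (simp add: twist_weight_def)

text \<open>The set of counted primes grows precisely if p divides neither n nor q; the factor
  equals 1 + |\<open>step_coeff p n\<close>|.\<close>

lemma twist_weight_prime_mult: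
  assumes "prime p" "n > 0"
  shows "twist_weight q (p * n) = (if p dvd n \<or> p dvd q then 1 else 2) * twist_weight q n"
proof -
  let ?P = "\<lambda>d. {p \<in> prime_factors d. \<not> p dvd q}"
  have fin: "finite (?P n)" by simp
  have "p * n \<noteq> 0" using assms prime_gt_0_nat by auto
  then have *: "r \<in> prime_factors (p * n) \<longleftrightarrow> r = p \<or> r \<in> prime_factors n" for r
    using assms by (auto simp: in_prime_factors_iff prime_dvd_mult_iff primes_dvd_imp_eq)
  have pn: "p \<in> prime_factors n \<longleftrightarrow> p dvd n" using assms by (auto simp: in_prime_factors_iff)
  show ?thesis
  proof (cases "p dvd n \<or> p dvd q")
    case True
    then have "?P (p * n) = ?P n" using * pn by auto
    then show ?thesis using True by (simp add: twist_weight_def)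
  next
    case False
    then have "?P (p * n) = insert p (?P n)" "p \<notin> ?P n" using * pn by auto
    then show ?thesis using False fin by (simp add: twist_weight_def)
  qed
qed

text \<open>The lcm of w with the largest such divisor is again such a divisor, so it cannot be
  larger: largest in size means largest for divisibility.\<close>

lemma dvd_Max_coprime_divisor:
  fixes u q w :: nat
  assumes u: "u > 0" and w: "w dvd u" "coprime w q"
  shows "w dvd Max {d. d dvd u \<and> coprime d q}"
proof -
  let ?D = "{d. d dvd u \<and> coprime d q}"
  have fin: "finite ?D" using u by (intro finite_subset[OF _ finite_divisors_nat[of u]]) auto
  define m where "m = Max ?D"
  have m: "m \<in> ?D" unfolding m_def using fin w by (intro Max_in) auto
  have "coprime (lcm w m) q"
  proof -
    have "lcm w m dvd w * m" by simp
    moreover have "coprime (w * m) q" using m w by simp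
    ultimately show ?thesis using coprime_divisors[of "lcm w m" "w * m" q q] by simp
  qed
  then have "lcm w m \<in> ?D" using m w by simp
  then have "lcm w m \<le> m" unfolding m_def using fin by (rule Max_ge[rotated])
  moreover have "m dvd lcm w m" "lcm w m > 0" using m w u by (auto intro!: Nat.gr0I)
  ultimately have "lcm w m = m" using dvd_imp_le le_antisym by blast
  then show ?thesis unfolding m_def[symmetric] by (metis dvd_lcm1)
qed

text \<open>The left side counts pairs (d, T) with d | u and T a set of primes dividing d but not q.
  Each pair is encoded as d times the T-part of u; that part is prime to q, hence divides u', and
  the code divides uu'.\<close>

lemma sum_twist_weight_le:
  assumes u: "u > 0"
  shows "(\<Sum>d\<in>{d. d dvd u}. twist_weight q d) \<le> num_divisors (u * Max {d. d dvd u \<and> coprime d q})"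
proof -
  define u' where "u' = Max {d. d dvd u \<and> coprime d q}"
  let ?P = "\<lambda>d. {p \<in> prime_factors d. \<not> p dvd q}"
  let ?X = "SIGMA d:{d. d dvd u}. Pow (?P d)"
  have finu: "finite {d. d dvd u}" using u by simp
  \<comment> \<open>$p \in T$ pushes the exponent of $p$ above its exponent in $u$, so $T$, and hence $d$, can be read off.\<close>
  define w where "w T = (\<Prod>p\<in>T. p ^ multiplicity p u)" for T
  define E where "E = (\<lambda>(d, T). d * w T)"
  have u'0: "u' > 0"
  proof -
    have "u' \<in> {d. d dvd u \<and> coprime d q}"
      unfolding u'_def using u by (intro Max_in finite_subset[OF _ finu]) auto
    then show ?thesis using u by (auto intro: Nat.gr0I)
  qed
  have T: "finite T" "\<And>p. p \<in> T \<Longrightarrow> prime p" "\<And>p. p \<in> T \<Longrightarrow> p dvd d" "\<And>p. p \<in> T \<Longrightarrow> \<not> p dvd q"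
    if "T \<in> Pow (?P d)" for T d
  proof -
    show "finite T" by (rule finite_subset[of _ "prime_factors d"]) (use that in auto)
  qed (use that in auto)
  have mult_E: "multiplicity p (E (d, T)) = multiplicity p d + (if p \<in> T then multiplicity p u else 0)"
    if "(d, T) \<in> ?X" "prime p" for d T p
  proof -
    have TP: "T \<in> Pow (?P d)" and "d dvd u" using that by auto
    have d0: "d \<noteq> 0" using \<open>d dvd u\<close> u by auto
    have w0: "w T \<noteq> 0" unfolding w_def using T(1,2)[OF TP] by (auto dest: prime_gt_0_nat)
    have "multiplicity p (w T) = (if p \<in> T then multiplicity p u else 0)"
      unfolding w_def using T(1,2)[OF TP] that(2) by (intro multiplicity_prod_prime_powers) auto
    then show ?thesis
      using that(2) d0 w0 by (simp add: E_def prime_elem_multiplicity_mult_distrib)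
  qed
  have inj: "inj_on E ?X"
  proof (rule inj_onI)
    fix a b assume ab: "a \<in> ?X" "b \<in> ?X" "E a = E b"
    obtain d T where a: "a = (d, T)" by (cases a)
    obtain d' T' where b: "b = (d', T')" by (cases b)
    have char: "p \<in> T \<longleftrightarrow> multiplicity p u < multiplicity p (E (d, T))"
      if X: "(d, T) \<in> ?X" and p: "prime p" for d T p
    proof -
      have "d dvd u" using X by simp
      then have "multiplicity p d \<le> multiplicity p u"
        using u by (intro dvd_imp_multiplicity_le) auto
      moreover have "multiplicity p d > 0" if "p \<in> T"
        using that X p u T(3)[of T d p] by (intro prime_multiplicity_gt_zero_iff[THEN iffD2]) (auto intro: Nat.gr0I)
      ultimately show ?thesis using mult_E[OF X p] by auto
    qed
    have "T = T'"
    proof (rule set_eqI)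
      fix p
      show "p \<in> T \<longleftrightarrow> p \<in> T'"
      proof (cases "prime p")
        case True
        show ?thesis using char[of d T p] char[of d' T' p] ab True by (simp only: a b)
      next
        case False
        then show ?thesis using T(2)[of T d p] T(2)[of T' d' p] ab by (auto simp: a b)
      qed
    qed
    moreover have "w T \<noteq> 0" unfolding w_def using T(1,2)[of T d] ab by (auto simp: a dest: prime_gt_0_nat)
    ultimately have "d = d'" using ab(3) by (simp add: a b E_def)
    then show "a = b" using \<open>T = T'\<close> by (simp add: a b)
  qed
  have sub: "E ` ?X \<subseteq> {e. e dvd u * u'}"
  proof
    fix e assume "e \<in> E ` ?X"
    then obtain d T where X: "(d, T) \<in> ?X" and e: "e = d * w T" by (auto simp: E_def)
    have TP: "T \<in> Pow (?P d)" and du: "d dvd u" using X by auto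
    \<comment> \<open>Hence \<open>w T\<close> is a part of the factorization of u.\<close>
    have "T \<subseteq> prime_factors u"
    proof
      fix p assume "p \<in> T"
      then show "p \<in> prime_factors u"
        using T(2,3)[OF TP, of p] du u dvd_trans[of p d u] by (simp add: in_prime_factors_iff)
    qed
    then have "w T dvd (\<Prod>p\<in>prime_factors u. p ^ multiplicity p u)"
      unfolding w_def by (intro prod_dvd_prod_subset) auto
    then have "w T dvd u" using u prime_factorization_nat[of u] by simp
    moreover have "coprime (w T) q"
      unfolding w_def using T(2,4)[OF TP]
      by (intro prod_coprime_left) (auto intro: prime_imp_coprime)
    ultimately have "w T dvd u'" unfolding u'_def using u by (intro dvd_Max_coprime_divisor)
    then show "e \<in> {e. e dvd u * u'}" using du by (simp add: e mult_dvd_mono)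
  qed
  have "(\<Sum>d\<in>{d. d dvd u}. twist_weight q d) = card ?X"
    using finu by (subst card_SigmaI) (auto simp: twist_weight_def card_Pow)
  also have "\<dots> = card (E ` ?X)" using inj by (simp add: card_image)
  also have "\<dots> \<le> card {e. e dvd u * u'}"
    using sub u u'0 by (intro card_mono finite_divisors_nat) auto
  finally show ?thesis by (simp add: num_divisors_def u'_def)
qed

lemma dil_op_sum:
  assumes "\<And>i. i \<in> I \<Longrightarrow> dil_op (A i) (r i)"
  shows "dil_op (\<lambda>f x. \<Sum>i\<in>I. c i * A i f x) (\<Sum>i\<in>I. norm (c i) * r i)"
  using assms
proof (induction I rule: infinite_finite_induct)
  case (insert i I)
  have "dil_op (\<lambda>f x. (\<Sum>i\<in>I. c i * A i f x) + c i * A i f x) ((\<Sum>i\<in>I. norm (c i) * r i) + norm (c i) * r i)"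
    using insert by (intro dil_op.add_scale) auto
  then show ?case using insert(1,2) by (simp add: add.commute)
qed (simp_all add: dil_op.zero)

lemma odd_ext_sum: "odd_ext (\<lambda>x. \<Sum>i\<in>I. c i * f i x) x = (\<Sum>i\<in>I. c i * odd_ext (f i) x)"
proof -
  have "(if P then \<Sum>i\<in>I. c i * g i else if Q then - (\<Sum>i\<in>I. c i * h i) else 0) =
      (\<Sum>i\<in>I. c i * (if P then g i else if Q then - h i else 0))" for P Q g h
    by (cases P; cases Q) (simp_all add: sum_negf)
  then show ?thesis unfolding odd_ext_def Let_def .
qed

context even_prim_char
begin

text \<open>The recursion applies T_p - c with c = \<open>step_coeff p m\<close>, which multiplies
  the bound on the coefficients by 1 + |c|; this is the growth of
  \<open>twist_weight\<close>.\<close>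

lemma S_eq_dil_op:
  assumes "n > 0"
  shows "\<exists>A. dil_op A (real (twist_weight q n)) \<and> nrm (\<lambda>x. S n x - A (S 1) x) = 0"
  using assms
proof (induction n rule: less_induct)
  case (less n)
  show ?case
  proof (cases "n = 1")
    case True
    then show ?thesis using dil_op.ident twist_weight_1
      by (intro exI[of _ "\<lambda>f. f"]) (simp add: nrm_def)
  next
    case False
    then obtain p where p: "prime p" "p dvd n" using prime_factor_nat by blast
    then obtain m where m: "n = p * m" by blast
    have mn: "m < n" "m > 0" using m less.prems p prime_gt_1_nat[of p] by auto
    have p0: "p > 0" using p(1) prime_gt_0_nat by blast
    obtain A where A: "dil_op A (real (twist_weight q m))" "nrm (\<lambda>x. S m x - A (S 1) x) = 0"
      using less.IH[OF mn] by blast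
    let ?c = "step_coeff p m"
    define B where "B = (\<lambda>f x. dil p (A f) x + (- ?c) * A f x)"
    have dB: "dil_op B (real (twist_weight q m) + norm (- ?c) * real (twist_weight q m))"
      unfolding B_def by (rule dil_op.add_scale[OF dil_op.dil[OF A(1) p0] A(1)])
    have "real (twist_weight q m) + norm (- ?c) * real (twist_weight q m) = real (twist_weight q n)"
    proof -
      have "coprime p q \<longleftrightarrow> \<not> p dvd q"
        using p(1) prime_imp_coprime[of p q] by (metis coprime_common_divisor dvd_refl not_prime_unit)
      then have "norm (\<psi> p) = (if p dvd q then 0 else 1)" by (simp only: norm_char if_not_P split: if_split) simp
      then have "norm (- ?c) = (if p dvd m \<or> p dvd q then 0 else 1)"
        by (cases "p dvd m") (simp_all only: step_coeff_def if_True if_False norm_minus_cancel norm_zero simp_thms)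
      then show ?thesis using twist_weight_prime_mult[OF p(1) mn(2), of q] by (simp add: m)
    qed
    then have dB': "dil_op B (real (twist_weight q n))" using dB by simp
    \<comment> \<open>The error at m has seminorm 0; applying T_p - c to it keeps it so, and it is
      one of the two parts of the error at n.\<close>
    define g where "g = (\<lambda>x. S m x - A (S 1) x)"
    have g: "g \<in> periodic_odd"
      unfolding g_def by (intro periodic_odd_diff S_periodic_odd dil_op_periodic_odd[OF A(1)])
    have "nrm (\<lambda>x. S n x - (dil p (S m) x - ?c * S m x)) = 0"
      using S_prime_mult[OF p(1) mn(2)] by (intro nrm_eq_0_ae) (simp add: m)
    moreover have "nrm (\<lambda>x. dil p g x + (- ?c) * g x) \<le> 0"
    proof -
      have "nrm (\<lambda>x. dil p g x + (- ?c) * g x) \<le> nrm (dil p g) + nrm (\<lambda>x. (- ?c) * g x)"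
        by (intro nrm_triangle periodic_odd_L2 periodic_odd_dil periodic_odd_scale g)
      also have "\<dots> = 0" unfolding nrm_dil[OF g p0] nrm_scale using A(2) by (simp add: g_def)
      finally show ?thesis .
    qed
    moreover have "nrm (\<lambda>x. (S n x - (dil p (S m) x - ?c * S m x)) + (dil p g x + (- ?c) * g x)) \<le>
        nrm (\<lambda>x. S n x - (dil p (S m) x - ?c * S m x)) + nrm (\<lambda>x. dil p g x + (- ?c) * g x)"
      by (intro nrm_triangle periodic_odd_L2 periodic_odd_add periodic_odd_diff periodic_odd_dil
          periodic_odd_scale g S_periodic_odd)
    moreover have "(\<lambda>x. (S n x - (dil p (S m) x - ?c * S m x)) + (dil p g x + (- ?c) * g x)) =
        (\<lambda>x. S n x - B (S 1) x)"
      by (simp add: fun_eq_iff B_def g_def dil_def algebra_simps)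
    ultimately have "nrm (\<lambda>x. S n x - B (S 1) x) \<le> 0" by simp
    then have "nrm (\<lambda>x. S n x - B (S 1) x) = 0" by (simp add: antisym)
    then show ?thesis using dB' by blast
  qed
qed

text \<open>Divided by c_1, the combination is S_1 - B S_1 up to seminorm 0, where B is a polynomial
  in dilations whose coefficients have absolute sum below 1; \<open>neumann\<close> then
  applies.\<close>

lemma S_1_mem_of_combination:
  assumes M: "dilation_invariant M" and u: "u > 0"
    and c: "(\<Sum>d\<in>{d. d dvd u \<and> d > 1}. norm (c d) * real (twist_weight q d)) < norm (c 1)"
    and mem: "(\<lambda>x. \<Sum>d\<in>{d. d dvd u}. c d * S d x) \<in> M"
  shows "S 1 \<in> M"
proof -
  interpret dilation_invariant M by fact
  let ?D = "{d. d dvd u \<and> d > 1}"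
  have finu: "finite {d. d dvd u}" using u by simp
  then have finD: "finite ?D" by (rule rev_finite_subset) auto
  have split: "{d. d dvd u} = insert 1 ?D" using u by (auto intro: Nat.gr0I)
  have "0 \<le> (\<Sum>d\<in>?D. norm (c d) * real (twist_weight q d))" by (intro sum_nonneg) auto
  then have c1: "norm (c 1) > 0" using c by linarith
  have "\<forall>d\<in>?D. \<exists>A. dil_op A (real (twist_weight q d)) \<and> nrm (\<lambda>x. S d x - A (S 1) x) = 0"
    by (intro ballI S_eq_dil_op) auto
  then obtain A where A: "\<And>d. d \<in> ?D \<Longrightarrow> dil_op (A d) (real (twist_weight q d))"
      "\<And>d. d \<in> ?D \<Longrightarrow> nrm (\<lambda>x. S d x - A d (S 1) x) = 0"
    by metis
  define b where "b d = - (c d / c 1)" for d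
  define B where "B = (\<lambda>f x. \<Sum>d\<in>?D. b d * A d f x)"
  have dB: "dil_op B (\<Sum>d\<in>?D. norm (b d) * real (twist_weight q d))"
    unfolding B_def by (intro dil_op_sum A)
  have "(\<Sum>d\<in>?D. norm (b d) * real (twist_weight q d)) =
      (\<Sum>d\<in>?D. norm (c d) * real (twist_weight q d)) / norm (c 1)"
    by (simp add: b_def norm_divide sum_divide_distrib)
  then have less: "(\<Sum>d\<in>?D. norm (b d) * real (twist_weight q d)) < 1"
    using c c1 by simp
  let ?\<Phi> = "\<lambda>x. 1 / c 1 * (\<Sum>d\<in>{d. d dvd u}. c d * S d x)"
  have BV: "B (S 1) \<in> periodic_odd" by (rule dil_op_periodic_odd[OF dB S_periodic_odd])
  have eq: "(\<lambda>x. (S 1 x - B (S 1) x) - ?\<Phi> x) = (\<lambda>x. \<Sum>d\<in>?D. b d * (S d x - A d (S 1) x))"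
  proof
    fix x
    have "?\<Phi> x = S 1 x - (\<Sum>d\<in>?D. b d * S d x)"
      unfolding split using finD c1
      by (simp add: b_def distrib_left sum_distrib_left sum_negf)
    then show "(S 1 x - B (S 1) x) - ?\<Phi> x = (\<Sum>d\<in>?D. b d * (S d x - A d (S 1) x))"
      by (simp add: B_def right_diff_distrib sum_subtractf)
  qed
  have "nrm (\<lambda>x. \<Sum>d\<in>?D. b d * (S d x - A d (S 1) x)) \<le>
      (\<Sum>d\<in>?D. nrm (\<lambda>x. b d * (S d x - A d (S 1) x)))"
    using dil_op_periodic_odd[OF A(1) S_periodic_odd]
    by (intro nrm_sum periodic_odd_scale periodic_odd_diff S_periodic_odd)
  also have "\<dots> = 0" unfolding nrm_scale using A(2) by simp
  finally have "nrm (\<lambda>x. (S 1 x - B (S 1) x) - ?\<Phi> x) = 0" unfolding eq by (simp add: antisym)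
  then have "(\<lambda>x. S 1 x - B (S 1) x) \<in> M"
    by (rule nrm_eq_0[OF scale[OF mem] periodic_odd_diff[OF S_periodic_odd BV]])
  then show ?thesis by (rule neumann[OF dB less S_periodic_odd])
qed

text \<open>Each |c_d| is at most the maximum, and the weights over d > 1 sum to the total minus the
  weight 1 of d = 1.\<close>

lemma combination_bound:
  assumes u: "u > 0" "even u"
    and c: "norm (c 1) > (real (num_divisors (u * Max {d. d dvd u \<and> coprime d q})) - 1)
                       * Max ((\<lambda>d. norm (c d :: complex)) ` {d. d dvd u \<and> d > 1})"
  shows "(\<Sum>d\<in>{d. d dvd u \<and> d > 1}. norm (c d) * real (twist_weight q d)) < norm (c 1)"
proof -
  let ?D = "{d. d dvd u \<and> d > 1}"
  have finu: "finite {d. d dvd u}" using u by simp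
  then have finD: "finite ?D" by (rule rev_finite_subset) auto
  define K where "K = Max ((\<lambda>d. norm (c d)) ` ?D)"
  have K: "norm (c d) \<le> K" if "d \<in> ?D" for d
    unfolding K_def using finD that by (intro Max_ge) auto
  \<comment> \<open>As u is even, 2 is among the indices, so the maximum is over a nonempty set of
    norms and is nonnegative.\<close>
  have "2 \<in> ?D" using u by simp
  then have "K \<ge> 0" using K[of 2] norm_ge_zero order_trans by blast
  have split: "{d. d dvd u} = insert 1 ?D" using u by (auto intro: Nat.gr0I)
  have "(\<Sum>d\<in>?D. norm (c d) * real (twist_weight q d)) \<le> (\<Sum>d\<in>?D. K * real (twist_weight q d))"
    using K by (intro sum_mono mult_right_mono) auto
  also have "\<dots> = (real (\<Sum>d\<in>{d. d dvd u}. twist_weight q d) - 1) * K"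
    unfolding split using finD by (simp add: twist_weight_1[unfolded One_nat_def] sum_distrib_left mult.commute)
  also have "\<dots> \<le> (real (num_divisors (u * Max {d. d dvd u \<and> coprime d q})) - 1) * K"
    using sum_twist_weight_le[OF u(1), of q] \<open>K \<ge> 0\<close> by (intro mult_right_mono diff_right_mono of_nat_mono) auto
  finally show ?thesis using c by (simp add: K_def)
qed

end

theorem theorem1p5:
  fixes \<psi> :: "nat \<Rightarrow> complex" and q :: nat
  assumes prim: "primitive_char q \<psi>" and q1: "q > 1" and even: "\<psi> (q - 1) = 1"
  shows "(\<forall>v::nat. v > 0 \<and> squarefree v \<and> coprime v q \<longrightarrow> cyclic_C (S_fun \<psi> q v))
    \<and> (\<forall>(u::nat) (c::nat \<Rightarrow> complex). u > 0 \<and> even u \<and>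
         norm (c 1) > (real (num_divisors (u * Max {d. d dvd u \<and> coprime d q})) - 1)
                       * Max ((\<lambda>d. norm (c d)) ` {d. d dvd u \<and> d > 1})
         \<longrightarrow> cyclic_C (\<lambda>x. \<Sum>d\<in>{d. d dvd u}. c d * S_fun \<psi> q d x))"
proof -
  interpret even_prim_char q \<psi>
    by unfold_locales (fact prim q1 even)+
  show ?thesis
  proof (intro conjI allI impI)
    fix v :: nat assume "v > 0 \<and> squarefree v \<and> coprime v q"
    then show "cyclic_C (S_fun \<psi> q v)"
      using sn_1_mem_of_S_1 S_1_mem_of_squarefree
      by (intro cyclic_C_criterion S_fun_L2 S_periodic_odd) blast
  next
    fix u :: nat and c :: "nat \<Rightarrow> complex"
    assume u: "u > 0 \<and> even u \<and>
         norm (c 1) > (real (num_divisors (u * Max {d. d dvd u \<and> coprime d q})) - 1)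
                       * Max ((\<lambda>d. norm (c d)) ` {d. d dvd u \<and> d > 1})"
    have eq: "odd_ext (\<lambda>x. \<Sum>d\<in>{d. d dvd u}. c d * S_fun \<psi> q d x) = (\<lambda>x. \<Sum>d\<in>{d. d dvd u}. c d * S d x)"
      by (simp add: fun_eq_iff odd_ext_sum)
    show "cyclic_C (\<lambda>x. \<Sum>d\<in>{d. d dvd u}. c d * S_fun \<psi> q d x)"
    proof (rule cyclic_C_criterion)
      have "(\<lambda>x. \<Sum>d\<in>I. c d * S_fun \<psi> q d x) \<in> L2_01" for I
      proof (induction I rule: infinite_finite_induct)
        case (insert d I)
        have "(\<lambda>x. c d * S_fun \<psi> q d x + (\<Sum>d\<in>I. c d * S_fun \<psi> q d x)) \<in> L2_01"
          by (intro L2_01_add L2_01_scale S_fun_L2 insert.IH)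
        then show ?case using insert.hyps by simp
      qed (simp_all add: periodic_odd_L2 periodic_odd_zero)
      then show "(\<lambda>x. \<Sum>d\<in>{d. d dvd u}. c d * S_fun \<psi> q d x) \<in> L2_01" .
      show "odd_ext (\<lambda>x. \<Sum>d\<in>{d. d dvd u}. c d * S_fun \<psi> q d x) \<in> periodic_odd"
        unfolding eq by (intro periodic_odd_sum periodic_odd_scale S_periodic_odd)
      fix M assume M: "dilation_invariant M"
        "odd_ext (\<lambda>x. \<Sum>d\<in>{d. d dvd u}. c d * S_fun \<psi> q d x) \<in> M"
      have "S 1 \<in> M"
        using S_1_mem_of_combination[OF M(1) _ combination_bound M(2)[unfolded eq]] u by blast
      then show "sn 1 \<in> M" by (rule sn_1_mem_of_S_1[OF M(1)])
    qed
  qed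
qed

end
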